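(* Let $G$ be a locally compact second countable group, and let $\mu$ be a Borel measure on $G$ which is finite on compact subsets. Let $\pi:G\to U(\mathcal{H})$ be a unitary representation on a complex Hilbert space $\mathcal{H}$, and let $c(g)T=\pi(g)T\pi(g^{-1})$ be the corresponding representation of $G$ on the space $\mathcal{L}^1(\mathcal{H})$ of trace class operators. The following conditions are equivalent. (1) There exists $C>0$ such that for all $S,T\in\mathcal{L}^1(\mathcal{H})$ with $\|S\|_1=\|T\|_1=1$ we have $\int_G |\langle c(g)S,T\rangle|\,d\mu(g)<C$. (2) There exists $C>0$ such that for all unit vectors $\xi,\eta\in\mathcal{H}$ we have $\int_G|\langle \pi(g)\xi,\eta\rangle|^2\,d\mu(g)<C$. (3) For all $S,T\in\mathcal{L}^1(\mathcal{H})$ we have $\int_G|\langle c(g)S,T\rangle|\,d\mu(g)<\infty$. (4) For all $\xi,\eta\in\mathcal{H}$ we have $\int_G|\langle\pi(g)\xi,\eta\rangle|^2\,d\mu(g)<\infty$.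
   Context: $\mathcal{L}^2(\mathcal{H})$ is the Hilbert space of Hilbert-Schmidt operators on $\mathcal{H}$ with scalar product $\langle S,T\rangle=\mathrm{Tr}(ST^* )$. $\mathcal{L}^1(\mathcal{H})\subset\mathcal{L}^2(\mathcal{H})$ is the Banach space of trace class operators with the trace norm $\|\cdot\|_1$. The formula $c(g)T=\pi(g)T\pi(g^{-1})$ defines a unitary representation of $G$ on $\mathcal{L}^2(\mathcal{H})$ which restricts to an isometric representation on $(\mathcal{L}^1(\mathcal{H}),\|\cdot\|_1)$; for $S,T\in \mathcal{L}^1(\mathcal{H})$ the matrix coefficient $\langle c(g)S,T\rangle$ is taken with respect to the scalar product of $\mathcal{L}^2(\mathcal{H})$. Unitary representations are strongly continuous. *)

theory Defs
  imports "HOL-Analysis.Analysis"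
begin

text \<open>
  A complex Hilbert space, with \<open>cinner\<close> linear in the first argument. The real structure
  is the restriction of the complex one and the real inner product is the real part of \<open>cinner\<close>,
  so that \<open>norm x = sqrt (Re (cinner x x))\<close>. Positive definiteness, and with it the
  norm and topology axioms, are inherited from \<open>real_inner\<close>.
\<close>

class chilbert_space = real_inner + banach +
  fixes scaleC :: "complex \<Rightarrow> 'a \<Rightarrow> 'a"  (infixr \<open>*\<^sub>C\<close> 75)
    and cinner :: "'a \<Rightarrow> 'a \<Rightarrow> complex"
  assumes scaleC_add_right: "a *\<^sub>C (x + y) = a *\<^sub>C x + a *\<^sub>C y"
    and scaleC_add_left: "(a + b) *\<^sub>C x = a *\<^sub>C x + b *\<^sub>C x"
    and scaleC_scaleC: "a *\<^sub>C (b *\<^sub>C x) = (a * b) *\<^sub>C x"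
    and scaleC_one: "1 *\<^sub>C x = x"
    and scaleR_scaleC: "r *\<^sub>R x = complex_of_real r *\<^sub>C x"
    and cinner_add_left: "cinner (x + y) z = cinner x z + cinner y z"
    and cinner_scaleC_left: "cinner (a *\<^sub>C x) y = a * cinner x y"
    and cinner_commute: "cinner x y = cnj (cinner y x)"
    and inner_cinner: "inner x y = Re (cinner x y)"

definition is_onb :: "'h::chilbert_space set \<Rightarrow> bool" where
  "is_onb E \<longleftrightarrow>
     (\<forall>x\<in>E. \<forall>y\<in>E. cinner x y = (if x = y then 1 else 0)) \<and>
     closure (module.span (*\<^sub>C) E) = UNIV"

definition some_onb :: "'h::chilbert_space set" where
  "some_onb = (SOME E. is_onb E)"

definition bounded_clinear :: "('h::chilbert_space \<Rightarrow> 'h) \<Rightarrow> bool" where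
  "bounded_clinear T \<longleftrightarrow> bounded_linear T \<and> (\<forall>a x. T (a *\<^sub>C x) = a *\<^sub>C T x)"

definition cadjoint :: "('h::chilbert_space \<Rightarrow> 'h) \<Rightarrow> ('h \<Rightarrow> 'h)" where
  "cadjoint T = (THE S. \<forall>x y. cinner (T x) y = cinner x (S y))"

definition positive_op :: "('h::chilbert_space \<Rightarrow> 'h) \<Rightarrow> bool" where
  "positive_op A \<longleftrightarrow>
     bounded_clinear A \<and> (\<forall>x. cinner (A x) x \<in> \<real> \<and> 0 \<le> Re (cinner (A x) x))"

text \<open>The absolute value \<open>\<bar>T\<bar>\<close>, i.e. the unique positive square root of \<open>T\<^sup>* T\<close>.\<close>

definition abs_op :: "('h::chilbert_space \<Rightarrow> 'h) \<Rightarrow> ('h \<Rightarrow> 'h)" where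
  "abs_op T = (THE A. positive_op A \<and> A \<circ> A = cadjoint T \<circ> T)"

text \<open>
  Neither the trace of a trace class operator nor the trace of a positive operator depends on the
  orthonormal basis, so a fixed choice of basis is used. The index set may be uncountable.
\<close>

definition op_trace :: "('h::chilbert_space \<Rightarrow> 'h) \<Rightarrow> complex" where
  "op_trace T = (\<Sum>\<^sub>\<infinity>e\<in>some_onb. cinner (T e) e)"

definition trace_class :: "('h::chilbert_space \<Rightarrow> 'h) \<Rightarrow> bool" where
  "trace_class T \<longleftrightarrow>
     bounded_clinear T \<and> (\<lambda>e. cinner (abs_op T e) e) summable_on some_onb"

definition trace_norm :: "('h::chilbert_space \<Rightarrow> 'h) \<Rightarrow> real" where
  "trace_norm T = Re (op_trace (abs_op T))"

definition hs_inner :: "('h::chilbert_space \<Rightarrow> 'h) \<Rightarrow> ('h \<Rightarrow> 'h) \<Rightarrow> complex" where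
  "hs_inner S T = op_trace (S \<circ> cadjoint T)"

definition unitary_op :: "('h::chilbert_space \<Rightarrow> 'h) \<Rightarrow> bool" where
  "unitary_op U \<longleftrightarrow>
     bounded_clinear U \<and> surj U \<and> (\<forall>x y. cinner (U x) (U y) = cinner x y)"

text \<open>
  The group is written additively in order to use the class \<open>topological_group_add\<close>,
  which does not assume commutativity: \<open>g + h\<close> is the product, \<open>- g\<close> the inverse
  and \<open>0\<close> the identity of the group.
\<close>

definition unitary_rep :: "('g::topological_group_add \<Rightarrow> 'h::chilbert_space \<Rightarrow> 'h) \<Rightarrow> bool" where
  "unitary_rep \<pi> \<longleftrightarrow>
     (\<forall>g. unitary_op (\<pi> g)) \<and>
     (\<forall>g h. \<pi> (g + h) = \<pi> g \<circ> \<pi> h) \<and>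
     (\<forall>\<xi>. continuous_on UNIV (\<lambda>g. \<pi> g \<xi>))"

definition conj_rep ::
  "('g::topological_group_add \<Rightarrow> 'h::chilbert_space \<Rightarrow> 'h) \<Rightarrow> 'g \<Rightarrow> ('h \<Rightarrow> 'h) \<Rightarrow> ('h \<Rightarrow> 'h)" where
  "conj_rep \<pi> g T = \<pi> g \<circ> T \<circ> \<pi> (- g)"

end

theory Submission
  imports Defs
begin

text \<open>
  Write \<open>T = A R\<close> with \<open>R = \<bar>T\<bar>\<^sup>1\<^sup>/\<^sup>2\<close> and \<open>\<parallel>A x\<parallel> = \<parallel>R x\<parallel>\<close>, and similarly \<open>S = B Q\<close>. For an orthonormal basis \<open>E\<close>,
  \<open>\<langle>c(g)T, S\<rangle>\<close> is the sum over \<open>e, f \<in> E\<close> of \<open>\<langle>Q f, \<pi>(g) R e\<rangle> \<langle>\<pi>(g) A e, B f\<rangle>\<close>. By AM-GM its integral is at most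
  \<open>\<Sum>\<^sub>e\<^sub>,\<^sub>f K \<parallel>R e\<parallel>\<^sup>2 \<parallel>Q f\<parallel>\<^sup>2 = K \<parallel>T\<parallel>\<^sub>1 \<parallel>S\<parallel>\<^sub>1\<close> if \<open>K\<close> bounds the integrals for unit vectors. Conversely, rank one
  projections turn coefficients of \<open>c\<close> into squared coefficients of \<open>\<pi>\<close>. Finiteness for all vectors
  gives a uniform bound by Fatou's lemma and the Baire category theorem.
\<close>

subsection \<open>Complex inner products\<close>

text \<open>The even split through the square root of the absolute value makes both factors
  Hilbert-Schmidt with squared norm equal to the trace norm, so the two terms that AM-GM separates
  have the same bound. Since \<open>cadjoint\<close> and \<open>abs_op\<close> are definite
  descriptions, nothing is known about them before Riesz representation and the existence and
  uniqueness of positive square roots; these are built from orthonormal expansions and an iteration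
  rather than from spectral theory. The basis may be uncountable, which blocks an exchange of sums
  with the integral; Hilbert-Schmidt factors vanish on all but countably many basis vectors, and
  this countable support permits the exchange. For the uniform bound, the integral of the squared
  coefficient is treated as a squared seminorm in each vector separately, so the category argument
  is run twice, once per variable.\<close>

interpretation cvs: vector_space "scaleC :: complex \<Rightarrow> 'a::chilbert_space \<Rightarrow> 'a"
  by standard (simp_all add: scaleC_add_right scaleC_add_left scaleC_scaleC scaleC_one)

lemma cinner_add_right: "cinner x (y + z) = cinner x y + cinner x z"
  by (subst (1 2 3) cinner_commute) (simp add: cinner_add_left)

lemma cinner_scaleC_right: "cinner x (a *\<^sub>C y) = cnj a * cinner x y"
  by (subst (1 2) cinner_commute) (simp add: cinner_scaleC_left)

lemma cinner_self: "cinner x x = of_real ((norm x)\<^sup>2)"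
proof (rule complex_eqI)
  show "Im (cinner x x) = Im (of_real ((norm x)\<^sup>2))"
    using cinner_commute[of x x] by (simp add: complex_eq_iff)
qed (simp add: inner_cinner[symmetric] power2_norm_eq_inner)

lemma Re_cinner_self: "Re (cinner x x) = (norm x)\<^sup>2"
  by (simp add: cinner_self)

lemma norm_scaleC: "norm (a *\<^sub>C x) = norm a * norm x"
proof -
  have "complex_of_real ((norm (a *\<^sub>C x))\<^sup>2) = complex_of_real ((norm a * norm x)\<^sup>2)"
    unfolding cinner_self[symmetric] cinner_scaleC_left cinner_scaleC_right
    by (simp add: cinner_self power_mult_distrib complex_norm_square[unfolded of_real_power] mult_ac)
  then have "(norm (a *\<^sub>C x))\<^sup>2 = (norm a * norm x)\<^sup>2"
    using of_real_eq_iff by blast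
  then show ?thesis
    by (simp add: power2_eq_iff_nonneg)
qed

lemma norm_cinner_commute: "norm (cinner x y) = norm (cinner y x)"
  by (subst cinner_commute) simp

lemma Re_cinner_le: "Re (cinner x y) \<le> norm x * norm y"
  using norm_cauchy_schwarz[of x y] by (simp add: inner_cinner)

text \<open>Turning a number onto the nonnegative axis by a scalar of modulus 1 reduces
  Cauchy-Schwarz estimates for a complex form to estimates of its real part.\<close>

lemma unimodular_rotation: "\<exists>a. norm a = 1 \<and> a * z = of_real (norm z)" for z :: complex
proof (cases "z = 0")
  case False
  then show ?thesis
    by (intro exI[of _ "cnj z / of_real (norm z)"])
       (simp add: norm_divide divide_simps complex_norm_square[unfolded power2_eq_square of_real_mult] mult.commute)
qed (auto intro: exI[of _ 1])

lemma norm_cinner_le: "norm (cinner x y) \<le> norm x * norm y"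
proof -
  obtain a where a: "norm a = 1" "a * cinner x y = of_real (norm (cinner x y))"
    using unimodular_rotation by blast
  then have "norm (cinner x y) = Re (cinner (a *\<^sub>C x) y)"
    by (simp add: cinner_scaleC_left)
  also have "\<dots> \<le> norm x * norm y"
    using Re_cinner_le[of "a *\<^sub>C x" y] a by (simp add: norm_scaleC)
  finally show ?thesis .
qed

interpretation cinner: bounded_bilinear "cinner :: 'a::chilbert_space \<Rightarrow> 'a \<Rightarrow> complex"
proof
  show "\<exists>K. \<forall>a b::'a. norm (cinner a b) \<le> norm a * norm b * K"
    by (rule exI[of _ 1]) (simp add: norm_cinner_le)
qed (simp_all add: cinner_add_left cinner_add_right scaleR_scaleC cinner_scaleC_left
        cinner_scaleC_right scaleR_conv_of_real)

interpretation scaleC: bounded_bilinear "scaleC :: complex \<Rightarrow> 'a::chilbert_space \<Rightarrow> 'a"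
proof
  show "\<exists>K. \<forall>a (b::'a). norm (a *\<^sub>C b) \<le> norm a * norm b * K"
    by (rule exI[of _ 1]) (simp add: norm_scaleC)
qed (simp_all add: scaleC_add_left scaleC_add_right scaleR_scaleC scaleC_scaleC mult.commute
        scaleR_conv_of_real)

lemma cinner_ext: "(\<And>z. cinner x z = cinner y z) \<Longrightarrow> x = y"
  using cinner_self[of "x - y"] by (simp add: cinner.diff_left)

lemma cinner_ext': "(\<And>z. cinner z x = cinner z y) \<Longrightarrow> x = y"
  by (metis cinner_commute cinner_ext)

section \<open>Bounded complex linear operators\<close>

lemma bounded_clinear_bounded_linear: "bounded_clinear T \<Longrightarrow> bounded_linear T"
  by (simp add: bounded_clinear_def)

lemma bounded_clinear_scaleC: "bounded_clinear T \<Longrightarrow> T (a *\<^sub>C x) = a *\<^sub>C T x"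
  by (simp add: bounded_clinear_def)

lemma bounded_clinear_tendsto:
  "bounded_clinear T \<Longrightarrow> (f \<longlongrightarrow> l) F \<Longrightarrow> ((\<lambda>x. T (f x)) \<longlongrightarrow> T l) F"
  by (rule bounded_linear.tendsto[OF bounded_clinear_bounded_linear])

lemma bounded_clinear_bound:
  assumes "bounded_clinear T"
  obtains K where "K > 0" "\<And>x. norm (T x) \<le> K * norm x"
  using bounded_linear.pos_bounded[OF bounded_clinear_bounded_linear[OF assms]]
  by (auto simp: mult.commute)

lemma bounded_clinearI:
  assumes "\<And>x y. T (x + y) = T x + T y" "\<And>a x. T (a *\<^sub>C x) = a *\<^sub>C T x"
    and "\<And>x. norm (T x) \<le> K * norm x"
  shows "bounded_clinear T"
  unfolding bounded_clinear_def
  using assms by (auto intro!: bounded_linear_intro[of _ K] simp: scaleR_scaleC mult.commute)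

lemma bounded_clinear_compose:
  "bounded_clinear S \<Longrightarrow> bounded_clinear T \<Longrightarrow> bounded_clinear (\<lambda>x. S (T x))"
  by (simp add: bounded_clinear_def bounded_linear_compose)

lemma bounded_clinear_o:
  "bounded_clinear S \<Longrightarrow> bounded_clinear T \<Longrightarrow> bounded_clinear (S \<circ> T)"
  by (simp add: comp_def bounded_clinear_compose)

lemma bounded_clinear_id: "bounded_clinear (\<lambda>x. x)"
  by (simp add: bounded_clinear_def bounded_linear_ident)

lemma bounded_clinear_add:
  "bounded_clinear S \<Longrightarrow> bounded_clinear T \<Longrightarrow> bounded_clinear (\<lambda>x. S x + T x)"
  by (simp add: bounded_clinear_def bounded_linear_add scaleC_add_right)

lemma bounded_clinear_diff:
  "bounded_clinear S \<Longrightarrow> bounded_clinear T \<Longrightarrow> bounded_clinear (\<lambda>x. S x - T x)"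
  by (simp add: bounded_clinear_def bounded_linear_sub cvs.scale_right_diff_distrib)

lemma bounded_clinear_scale: "bounded_clinear T \<Longrightarrow> bounded_clinear (\<lambda>x. a *\<^sub>C T x)"
  by (simp add: bounded_clinear_def bounded_linear_compose[OF scaleC.bounded_linear_right]
      scaleC_scaleC mult.commute)

lemma bounded_clinear_scaleR: "bounded_clinear T \<Longrightarrow> bounded_clinear (\<lambda>x. r *\<^sub>R T x)"
  unfolding scaleR_scaleC by (rule bounded_clinear_scale)

lemma bounded_clinear_zero: "bounded_clinear (\<lambda>x. 0)"
  by (simp add: bounded_clinear_def)

lemma bounded_clinear_funpow:
  assumes "bounded_clinear T"
  shows "bounded_clinear (T ^^ n)"
  by (induction n)
     (simp_all add: bounded_clinear_o assms bounded_clinear_id id_def del: o_apply)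

lemma bounded_clinear_sum:
  assumes "\<And>i. i \<in> I \<Longrightarrow> bounded_clinear (T i)"
  shows "bounded_clinear (\<lambda>x. \<Sum>i\<in>I. T i x)"
  using assms
  by (induction I rule: infinite_finite_induct) (auto intro: bounded_clinear_add bounded_clinear_zero)

subsection \<open>Orthonormal bases\<close>

text \<open>Half of \<open>is_onb\<close>, separated because Zorn's lemma works with orthonormal
  sets whose span is not yet known to be dense.\<close>

definition orthonormal :: "'h::chilbert_space set \<Rightarrow> bool" where
  "orthonormal E \<longleftrightarrow> (\<forall>x\<in>E. \<forall>y\<in>E. cinner x y = (if x = y then 1 else 0))"

lemma orthonormal_cinner:
  "orthonormal E \<Longrightarrow> x \<in> E \<Longrightarrow> y \<in> E \<Longrightarrow> cinner x y = (if x = y then 1 else 0)"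
  by (simp add: orthonormal_def)

lemma cinner_sum_orthonormal:
  assumes "orthonormal E" "finite F" "F \<subseteq> E" "f \<in> F"
  shows "cinner (\<Sum>e\<in>F. a e *\<^sub>C e) f = a f"
proof -
  have "cinner (\<Sum>e\<in>F. a e *\<^sub>C e) f = (\<Sum>e\<in>F. if e = f then a e else 0)"
    unfolding cinner.sum_left cinner_scaleC_left
    using assms by (intro sum.cong refl) (auto simp: orthonormal_cinner subset_iff)
  then show ?thesis
    using assms by simp
qed

lemma norm_sum_orthonormal:
  assumes "orthonormal E" "finite F" "F \<subseteq> E"
  shows "(norm (\<Sum>e\<in>F. a e *\<^sub>C e))\<^sup>2 = (\<Sum>e\<in>F. (norm (a e))\<^sup>2)"
proof -
  let ?s = "\<Sum>e\<in>F. a e *\<^sub>C e"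
  have "cinner ?s ?s = (\<Sum>e\<in>F. cnj (a e) * cinner ?s e)"
    by (simp only: cinner.sum_right cinner_scaleC_right)
  also have "\<dots> = (\<Sum>e\<in>F. of_real ((norm (a e))\<^sup>2))"
    by (intro sum.cong refl)
       (simp only: cinner_sum_orthonormal[OF assms] complex_norm_square mult.commute)
  finally show ?thesis
    unfolding cinner_self of_real_sum[symmetric] of_real_eq_iff .
qed

text \<open>Completing the square in the coefficients. Setting them to \<open>cinner x e\<close>
  gives Bessel; leaving them free shows that the Fourier coefficients give the best
  approximation.\<close>

lemma norm_diff_sum_orthonormal:
  assumes "orthonormal E" "finite F" "F \<subseteq> E"
  shows "(norm (x - (\<Sum>e\<in>F. a e *\<^sub>C e)))\<^sup>2
    = (norm x)\<^sup>2 - (\<Sum>e\<in>F. (norm (cinner x e))\<^sup>2) + (\<Sum>e\<in>F. (norm (cinner x e - a e))\<^sup>2)"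
proof -
  let ?s = "\<Sum>e\<in>F. a e *\<^sub>C e"
  have [simp]: "cinner x ?s = (\<Sum>e\<in>F. cnj (a e) * cinner x e)"
    by (simp add: cinner.sum_right cinner_scaleC_right)
  have "(norm (x - ?s))\<^sup>2 = (norm x)\<^sup>2 - 2 * Re (cinner x ?s) + (norm ?s)\<^sup>2"
    by (simp add: power2_norm_eq_inner inner_diff_left inner_diff_right inner_commute
        inner_cinner[symmetric] del: \<open>cinner x ?s = _\<close>)
  also have "\<dots> = (norm x)\<^sup>2 + (\<Sum>e\<in>F. (norm (a e))\<^sup>2 - 2 * Re (cnj (a e) * cinner x e))"
    by (simp add: norm_sum_orthonormal[OF assms] sum_subtractf sum_distrib_left)
  also have "(\<Sum>e\<in>F. (norm (a e))\<^sup>2 - 2 * Re (cnj (a e) * cinner x e))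
     = (\<Sum>e\<in>F. (norm (cinner x e - a e))\<^sup>2 - (norm (cinner x e))\<^sup>2)"
    by (intro sum.cong refl, unfold cmod_power2) (simp add: power2_eq_square algebra_simps)
  finally show ?thesis
    by (simp add: sum_subtractf)
qed

lemma bessel:
  assumes "orthonormal E" "finite F" "F \<subseteq> E"
  shows "(\<Sum>e\<in>F. (norm (cinner x e))\<^sup>2) \<le> (norm x)\<^sup>2"
  using norm_diff_sum_orthonormal[OF assms, of x "cinner x"] zero_le_power2[of "norm (x - (\<Sum>e\<in>F. cinner x e *\<^sub>C e))"]
  by simp

text \<open>Finite sets containing \<open>F0\<close> share it, so their sums differ only by sums
  over finite sets outside \<open>F0\<close>. This form suits orthogonal series, which need not be
  absolutely summable.\<close>

lemma summable_on_cauchyI: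
  fixes f :: "'a \<Rightarrow> 'b::banach"
  assumes "\<And>e. e > 0 \<Longrightarrow> \<exists>F0. finite F0 \<and> F0 \<subseteq> A \<and>
      (\<forall>F. finite F \<longrightarrow> F \<subseteq> A - F0 \<longrightarrow> norm (sum f F) < e)"
  shows "f summable_on A"
proof -
  have "\<exists>P. eventually P (finite_subsets_at_top A) \<and>
      (\<forall>F F'. P F \<and> P F' \<longrightarrow> dist (sum f F) (sum f F') < e)" if "e > 0" for e
  proof -
    obtain F0 where F0: "finite F0" "F0 \<subseteq> A"
      "\<And>F. finite F \<Longrightarrow> F \<subseteq> A - F0 \<Longrightarrow> norm (sum f F) < e / 2"
      using assms[OF half_gt_zero[OF \<open>e > 0\<close>]] by blast
    define P where "P F \<longleftrightarrow> finite F \<and> F0 \<subseteq> F \<and> F \<subseteq> A" for F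
    have "dist (sum f F) (sum f F') < e" if "P F" "P F'" for F F'
    proof -
      have "sum f G = sum f F0 + sum f (G - F0)" if "P G" for G
        using that F0(1) unfolding P_def by (metis add.commute sum.subset_diff)
      then have "dist (sum f F) (sum f F') = norm (sum f (F - F0) - sum f (F' - F0))"
        using that by (simp add: dist_norm)
      also have "\<dots> \<le> norm (sum f (F - F0)) + norm (sum f (F' - F0))"
        by (rule norm_triangle_ineq4)
      also have "\<dots> < e / 2 + e / 2"
        using that unfolding P_def by (intro add_strict_mono F0(3)) auto
      finally show ?thesis by simp
    qed
    moreover have "eventually P (finite_subsets_at_top A)"
      using F0(1,2) unfolding eventually_finite_subsets_at_top P_def by blast
    ultimately show ?thesis by blast
  qed
  then have "cauchy_filter (filtermap (sum f) (finite_subsets_at_top A))"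
    by (simp add: cauchy_filter_metric_filtermap)
  moreover have "complete (UNIV::'b set)"
    by (meson Cauchy_convergent UNIV_I complete_def convergent_def)
  ultimately obtain l where "(sum f \<longlongrightarrow> l) (finite_subsets_at_top A)"
    using complete_uniform[where S=UNIV] by (force simp add: filterlim_def)
  then show ?thesis
    using summable_on_def has_sum_def by blast
qed

text \<open>By Pythagoras the squared norm of a finite piece is a piece of the convergent numerical
  series, so the Cauchy criterion applies.\<close>

lemma orthonormal_summable:
  assumes E: "orthonormal E" and a: "(\<lambda>e. (norm (a e))\<^sup>2) summable_on E"
  shows "(\<lambda>e. a e *\<^sub>C e) summable_on E"
proof (rule summable_on_cauchyI)
  fix r :: real assume r: "r > 0"
  let ?b = "\<lambda>e. (norm (a e))\<^sup>2"
  \<comment> \<open>The approximation is only non-strict, so half of r^2 leaves room for the strict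
    bound.\<close>
  obtain F0 where F0: "finite F0" "F0 \<subseteq> E" "dist (sum ?b F0) (infsum ?b E) \<le> r\<^sup>2 / 2"
    using infsum_finite_approximation[OF a, of "r\<^sup>2 / 2"] r by auto
  have "norm (\<Sum>e\<in>F. a e *\<^sub>C e) < r" if F: "finite F" "F \<subseteq> E - F0" for F
  proof -
    have "sum ?b F + sum ?b F0 = sum ?b (F \<union> F0)"
      using F F0 by (intro sum.union_disjoint[symmetric]) auto
    also have "\<dots> \<le> infsum ?b E"
      using F F0 by (intro finite_sum_le_infsum[OF a]) auto
    finally have "sum ?b F \<le> r\<^sup>2 / 2"
      using F0(3) unfolding dist_real_def by linarith
    also have "\<dots> < r\<^sup>2" using r by simp
    also have "sum ?b F = (norm (\<Sum>e\<in>F. a e *\<^sub>C e))\<^sup>2"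
      using F by (intro norm_sum_orthonormal[symmetric, OF E]) auto
    finally show ?thesis
      using r by (simp add: power2_less_imp_less)
  qed
  with F0 show "\<exists>F0. finite F0 \<and> F0 \<subseteq> E \<and>
      (\<forall>F. finite F \<longrightarrow> F \<subseteq> E - F0 \<longrightarrow> norm (\<Sum>e\<in>F. a e *\<^sub>C e) < r)"
    by blast
qed

lemma bessel_summable:
  assumes "orthonormal E"
  shows "(\<lambda>e. (norm (cinner x e))\<^sup>2) summable_on E"
  by (rule nonneg_bdd_above_summable_on)
     (use bessel[OF assms] in \<open>auto intro!: bdd_aboveI[of _ "(norm x)\<^sup>2"]\<close>)

lemma cinner_infsum_orthonormal:
  assumes E: "orthonormal E" and s: "((\<lambda>e. a e *\<^sub>C e) has_sum s) E" and f: "f \<in> E"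
  shows "cinner s f = a f"
proof -
  have "((\<lambda>e. cinner (a e *\<^sub>C e) f) has_sum cinner s f) E"
    by (rule has_sum_bounded_linear[OF cinner.bounded_linear_left s])
  moreover have "((\<lambda>e. cinner (a e *\<^sub>C e) f) has_sum a f) E \<longleftrightarrow> ((\<lambda>e. a f) has_sum a f) {f}"
    using f E by (intro has_sum_cong_neutral) (auto simp: cinner_scaleC_left orthonormal_cinner)
  ultimately show ?thesis
    using has_sum_unique by (metis (mono_tags) has_sum_finiteI finite.intros sum.insert sum.empty empty_iff add.right_neutral)
qed

lemma infsum_in_closure_span:
  assumes s: "((\<lambda>e. a e *\<^sub>C e) has_sum s) E"
  shows "s \<in> closure (cvs.span E)"
proof -
  have "\<forall>\<^sub>F F in finite_subsets_at_top E. (\<Sum>e\<in>F. a e *\<^sub>C e) \<in> closure (cvs.span E)"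
  proof (rule eventually_finite_subsets_at_top_weakI)
    fix F assume "finite F" "F \<subseteq> E"
    then have "(\<Sum>e\<in>F. a e *\<^sub>C e) \<in> cvs.span E"
      by (intro cvs.span_sum cvs.span_scale cvs.span_base) auto
    then show "(\<Sum>e\<in>F. a e *\<^sub>C e) \<in> closure (cvs.span E)"
      using closure_subset by blast
  qed
  then show ?thesis
    using s unfolding has_sum_def
    by (rule Lim_in_closed_set[OF closed_closure _ finite_subsets_at_top_neq_bot])
qed

lemma is_onb_orthonormal: "is_onb E \<Longrightarrow> orthonormal E"
  by (simp add: is_onb_def orthonormal_def)

text \<open>A maximal orthonormal set spans densely: the residual of a Fourier series is orthogonal
  to the set, and if it were nonzero its normalisation could be adjoined.\<close>

lemma exists_onb: "\<exists>E::'h::chilbert_space set. is_onb E"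
proof -
  define \<C> where "\<C> = {E::'h set. orthonormal E}"
  have "\<exists>M\<in>\<C>. \<forall>X\<in>\<C>. M \<subseteq> X \<longrightarrow> X = M"
  proof (rule subset_Zorn_nonempty)
    show "\<C> \<noteq> {}"
      by (auto simp: \<C>_def orthonormal_def intro: exI[of _ "{}"])
    fix C assume C: "C \<noteq> {}" "subset.chain \<C> C"
    show "\<Union>C \<in> \<C>"
      unfolding \<C>_def orthonormal_def
    proof (intro CollectI ballI)
      fix x y assume "x \<in> \<Union>C" "y \<in> \<Union>C"
      then obtain X Y where XY: "X \<in> C" "x \<in> X" "Y \<in> C" "y \<in> Y"
        by blast
      then have "X \<subseteq> Y \<or> Y \<subseteq> X"
        using C(2) by (auto simp: subset_chain_def)
      then obtain X where "X \<in> C" "x \<in> X" "y \<in> X"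
        using XY by blast
      then show "cinner x y = (if x = y then 1 else 0)"
        using C(2) by (auto simp: subset_chain_def \<C>_def orthonormal_def)
    qed
  qed
  then obtain E where "orthonormal E" and max': "\<forall>X\<in>\<C>. E \<subseteq> X \<longrightarrow> X = E"
    unfolding \<C>_def mem_Collect_eq by (elim bexE) simp
  then have E: "orthonormal E" and max: "\<And>X. orthonormal X \<Longrightarrow> E \<subseteq> X \<Longrightarrow> X = E"
    unfolding \<C>_def by simp_all
  have "x \<in> closure (cvs.span E)" for x
  proof -
    obtain s where s: "((\<lambda>e. cinner x e *\<^sub>C e) has_sum s) E"
      using orthonormal_summable[OF E bessel_summable[OF E]] unfolding summable_on_def by blast
    define d where "d = x - s"
    have d: "cinner d e = 0" if "e \<in> E" for e
      using cinner_infsum_orthonormal[OF E s that] by (simp add: d_def cinner.diff_left)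
    have "d = 0"
    proof (rule ccontr)
      assume nz: "d \<noteq> 0"
      define u where "u = complex_of_real (1 / norm d) *\<^sub>C d"
      have u: "cinner u u = 1"
        using nz unfolding u_def by (simp add: cinner_self norm_scaleC norm_divide)
      have ue: "cinner u e = 0" "cinner e u = 0" if "e \<in> E" for e
        using d[OF that] cinner_commute[of e d]
        by (auto simp: u_def cinner_scaleC_left cinner_scaleC_right)
      have "orthonormal (insert u E)"
        using E u ue unfolding orthonormal_def by (auto split: if_splits)
      then have "u \<in> E" using max by blast
      then show False using ue(1)[of u] u by simp
    qed
    then show ?thesis
      using infsum_in_closure_span[OF s] by (simp add: d_def)
  qed
  then show ?thesis
    using E unfolding is_onb_def orthonormal_def by blast
qed

lemma some_onb: "is_onb some_onb"
  unfolding some_onb_def by (rule someI_ex[OF exists_onb])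

text \<open>Density supplies some finite combination near \<open>x\<close>; by best approximation
  the Fourier sum over any larger finite set is at least as near.\<close>

lemma onb_expansion:
  assumes "is_onb E"
  shows "((\<lambda>e. cinner x e *\<^sub>C e) has_sum x) E"
proof -
  have E: "orthonormal E" by (rule is_onb_orthonormal[OF assms])
  have "\<forall>\<^sub>F F in finite_subsets_at_top E. dist (\<Sum>e\<in>F. cinner x e *\<^sub>C e) x < r" if "r > 0" for r
  proof -
    have "x \<in> closure (cvs.span E)"
      using assms by (simp add: is_onb_def)
    then obtain y where y: "y \<in> cvs.span E" "dist y x < r"
      unfolding closure_approachable using \<open>r > 0\<close> by blast
    then obtain t a where t: "finite t" "t \<subseteq> E" "y = (\<Sum>e\<in>t. a e *\<^sub>C e)"
      unfolding cvs.span_explicit mem_Collect_eq by (elim exE conjE) (rule that)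
    have "dist (\<Sum>e\<in>F. cinner x e *\<^sub>C e) x < r" if F: "finite F" "t \<subseteq> F" "F \<subseteq> E" for F
    proof -
      \<comment> \<open>Padding with zero coefficients makes \<open>y\<close> a competitor over the
        larger set \<open>F\<close>.\<close>
      have "y = (\<Sum>e\<in>F. (if e \<in> t then a e else 0) *\<^sub>C e)"
        unfolding t(3) using F by (intro sum.mono_neutral_cong_left) auto
      then have "(norm (x - (\<Sum>e\<in>F. cinner x e *\<^sub>C e)))\<^sup>2 \<le> (norm (x - y))\<^sup>2"
        using F by (simp only: norm_diff_sum_orthonormal[OF E]) (simp add: sum_nonneg)
      then have "norm (x - (\<Sum>e\<in>F. cinner x e *\<^sub>C e)) \<le> norm (x - y)"
        by (rule power2_le_imp_le) simp
      then show ?thesis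
        using y(2) by (simp add: dist_norm norm_minus_commute)
    qed
    then show ?thesis
      using t(1,2) unfolding eventually_finite_subsets_at_top by blast
  qed
  then show ?thesis
    unfolding has_sum_def by (rule tendstoI)
qed

lemma parseval_cinner:
  assumes "is_onb E"
  shows "((\<lambda>e. cinner x e * cinner e y) has_sum cinner x y) E"
  using has_sum_bounded_linear[OF cinner.bounded_linear_left onb_expansion[OF assms, of x], of y]
  by (simp add: cinner_scaleC_left)

lemma parseval:
  assumes "is_onb E"
  shows "((\<lambda>e. (norm (cinner x e))\<^sup>2) has_sum (norm x)\<^sup>2) E"
proof -
  have "((\<lambda>e. Re (cinner x e * cinner e x)) has_sum Re (cinner x x)) E"
    by (rule has_sum_Re[OF parseval_cinner[OF assms]])
  moreover have "Re (cinner x e * cinner e x) = (norm (cinner x e))\<^sup>2" for e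
    by (subst (2) cinner_commute) (simp add: complex_norm_square[symmetric] del: of_real_power)
  ultimately show ?thesis
    by (simp add: Re_cinner_self)
qed

text \<open>The representing vector must have the coefficients \<open>cnj (f e)\<close>. They are
  square summable because testing \<open>f\<close> on their finite partial sums bounds the norms of
  these sums by \<open>K\<close>.\<close>

lemma riesz:
  fixes f :: "'h::chilbert_space \<Rightarrow> complex"
  assumes f: "bounded_linear f" and sc: "\<And>a x. f (a *\<^sub>C x) = a * f x"
  shows "\<exists>y. \<forall>x. f x = cinner x y"
proof -
  let ?E = "some_onb :: 'h set"
  have E: "orthonormal ?E" by (rule is_onb_orthonormal[OF some_onb])
  interpret f: bounded_linear f by fact
  obtain K where K: "K > 0" "\<And>x. norm (f x) \<le> norm x * K"
    using f.pos_bounded by auto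
  have "(\<lambda>e. (norm (cnj (f e)))\<^sup>2) summable_on ?E"
  proof (rule nonneg_bdd_above_summable_on)
    have "(\<Sum>e\<in>F. (norm (f e))\<^sup>2) \<le> K\<^sup>2" if F: "finite F" "F \<subseteq> ?E" for F
    proof -
      let ?S = "\<Sum>e\<in>F. (norm (f e))\<^sup>2" and ?v = "\<Sum>e\<in>F. cnj (f e) *\<^sub>C e"
      have S: "?S = (norm ?v)\<^sup>2"
        using norm_sum_orthonormal[OF E F, of "\<lambda>e. cnj (f e)"] by simp
      have "f ?v = of_real ?S"
        unfolding f.sum sc of_real_sum by (intro sum.cong refl) (simp only: complex_norm_square mult.commute)
      then have "norm (f ?v) = \<bar>?S\<bar>"
        by (simp only: norm_of_real)
      then have "?S = norm (f ?v)"
        by (simp add: sum_nonneg)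
      also have "\<dots> \<le> norm ?v * K" by (rule K)
      finally have "norm ?v * norm ?v \<le> norm ?v * K"
        unfolding S by (simp add: power2_eq_square)
      then have "norm ?v \<le> K"
        using K(1) by (cases "norm ?v = 0") (auto simp: mult_le_cancel_left)
      then show ?thesis
        unfolding S by (simp add: power_mono)
    qed
    then show "bdd_above (sum (\<lambda>e. (norm (cnj (f e)))\<^sup>2) ` {F. F \<subseteq> ?E \<and> finite F})"
      by (auto intro!: bdd_aboveI[of _ "K\<^sup>2"])
  qed simp
  from orthonormal_summable[OF E this] obtain y where y: "((\<lambda>e. cnj (f e) *\<^sub>C e) has_sum y) ?E"
    unfolding summable_on_def by blast
  have "f x = cinner x y" for x
  proof -
    have "((\<lambda>e. f (cinner x e *\<^sub>C e)) has_sum f x) ?E"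
      by (rule has_sum_bounded_linear[OF f onb_expansion[OF some_onb]])
    moreover have "((\<lambda>e. cinner x (cnj (f e) *\<^sub>C e)) has_sum cinner x y) ?E"
      by (rule has_sum_bounded_linear[OF cinner.bounded_linear_right y])
    ultimately show ?thesis
      by (auto simp: sc cinner_scaleC_right mult.commute intro: has_sum_unique)
  qed
  then show ?thesis by blast
qed

subsection \<open>Adjoints\<close>

text \<open>Inner products separate vectors, so the description behind \<open>cadjoint\<close> has
  at most one solution.\<close>

lemma cadjoint_eqI:
  assumes "\<And>x y. cinner (T x) y = cinner x (S y)"
  shows "cadjoint T = S"
  unfolding cadjoint_def
proof (rule the_equality)
  fix S' assume "\<forall>x y. cinner (T x) y = cinner x (S' y)"
  then have "cinner x (S' y) = cinner x (S y)" for x y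
    using assms by simp
  then show "S' = S" by (intro ext cinner_ext')
qed (use assms in blast)

lemma cinner_cadjoint:
  assumes "bounded_clinear T"
  shows "cinner (T x) y = cinner x (cadjoint T y)"
proof -
  have "\<exists>z. \<forall>x. cinner (T x) y = cinner x z" for y
    using assms unfolding bounded_clinear_def
    by (intro riesz) (auto intro: bounded_linear_compose[OF cinner.bounded_linear_left]
        simp: cinner_scaleC_left)
  then obtain S where S: "\<And>x y. cinner (T x) y = cinner x (S y)"
    by metis
  then show ?thesis
    using cadjoint_eqI[of T S] by simp
qed

lemma cinner_cadjoint':
  assumes "bounded_clinear T"
  shows "cinner x (T y) = cinner (cadjoint T x) y"
  using cinner_cadjoint[OF assms, of y x] by (metis cinner_commute)

lemma bounded_clinear_cadjoint:
  assumes "bounded_clinear T"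
  shows "bounded_clinear (cadjoint T)"
proof -
  obtain K where K: "K > 0" "\<And>x. norm (T x) \<le> K * norm x"
    using bounded_clinear_bound[OF assms] by blast
  have "norm (cadjoint T y) \<le> K * norm y" for y
  proof -
    \<comment> \<open>Testing against the image itself turns the bound for \<open>T\<close> into one
      for its adjoint, after cancelling one factor \<open>norm ?z\<close>.\<close>
    let ?z = "cadjoint T y"
    have "(norm ?z)\<^sup>2 = Re (cinner (T ?z) y)"
      by (simp add: cinner_cadjoint[OF assms] Re_cinner_self)
    also have "\<dots> \<le> norm (T ?z) * norm y" by (rule Re_cinner_le)
    also have "\<dots> \<le> K * norm ?z * norm y" by (intro mult_right_mono K) simp
    finally have "norm ?z * norm ?z \<le> norm ?z * (K * norm y)"
      by (simp add: power2_eq_square mult_ac)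
    then show ?thesis
      using K(1) by (cases "norm ?z = 0") (auto simp: mult_le_cancel_left)
  qed
  then show ?thesis
    by (intro bounded_clinearI cinner_ext' [of "cadjoint T (_ + _)"] cinner_ext' [of "cadjoint T (_ *\<^sub>C _)"])
       (simp_all add: cinner_cadjoint[OF assms, symmetric] cinner_add_right cinner_scaleC_right)
qed

subsection \<open>Positive operators and their square roots\<close>

lemma positive_op_bounded_clinear: "positive_op A \<Longrightarrow> bounded_clinear A"
  by (simp add: positive_op_def)

lemma positive_op_nonneg: "positive_op A \<Longrightarrow> 0 \<le> Re (cinner (A x) x)"
  by (simp add: positive_op_def)

lemma hermitian_cinner_Reals:
  assumes "\<And>x y. cinner (A x) y = cinner x (A y)"
  shows "cinner (A x) x \<in> \<real>"
  by (metis assms cinner_commute Reals_cnj_iff)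

text \<open>Polarisation: the defect \<open>h\<close> is sesquilinear and zero on the diagonal, and
  over the complex numbers this forces it to vanish.\<close>

lemma positive_op_hermitian:
  assumes A: "positive_op A"
  shows "cinner (A x) y = cinner x (A y)"
proof -
  define h where "h x y = cinner (A x) y - cinner x (A y)" for x y
  note lin = linear_simps[OF bounded_clinear_bounded_linear[OF positive_op_bounded_clinear[OF A]]]
    bounded_clinear_scaleC[OF positive_op_bounded_clinear[OF A]]
  have h0: "h z z = 0" for z
    using A unfolding positive_op_def h_def
    by (metis cinner_commute cancel_comm_monoid_add_class.diff_cancel Reals_cnj_iff)
  have "h x y + h y x = 0" for x y
    using h0[of "x + y"] h0[of x] h0[of y]
    by (simp add: h_def lin cinner_add_left cinner_add_right algebra_simps)
  \<comment> \<open>Multiplying \<open>x\<close> by the imaginary unit flips the relative sign of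
    the two terms, so their sum and their difference both vanish.\<close>
  from this[of x y] this[of "\<i> *\<^sub>C x" y] have "h x y + h y x = 0" "\<i> * (h x y - h y x) = 0"
    by (simp_all add: h_def lin cinner_scaleC_left cinner_scaleC_right algebra_simps)
  then have "h x y = 0" by simp
  then show ?thesis by (simp add: h_def)
qed

text \<open>The discriminant argument for a semidefinite form; the form may be degenerate, so a
  vanishing leading coefficient is treated apart.\<close>

lemma positive_op_cauchy_schwarz:
  assumes A: "positive_op A"
  shows "(norm (cinner (A x) y))\<^sup>2 \<le> Re (cinner (A x) x) * Re (cinner (A y) y)"
proof -
  note lin = linear_simps[OF bounded_clinear_bounded_linear[OF positive_op_bounded_clinear[OF A]]]
    bounded_clinear_scaleC[OF positive_op_bounded_clinear[OF A]]
  define q where "q z = Re (cinner (A z) z)" for z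
  define r where "r = norm (cinner (A x) y)"
  obtain a where a: "norm a = 1" "a * cinner (A x) y = of_real r"
    using unimodular_rotation unfolding r_def by blast
  define u where "u = a *\<^sub>C x"
  have u: "cinner (A u) y = of_real r"
    by (simp add: u_def lin cinner_scaleC_left a)
  have u': "cinner (A y) u = of_real r"
    using u positive_op_hermitian[OF A, of y u] cinner_commute[of y "A u"] by simp
  have "q u = Re ((a * cnj a) * cinner (A x) x)"
    by (simp add: q_def u_def lin cinner_scaleC_left cinner_scaleC_right mult_ac)
  also have "a * cnj a = 1"
    using a(1) by (simp add: complex_norm_square[symmetric])
  finally have qu: "q u = q x" by (simp add: q_def)
  have quad: "0 \<le> t\<^sup>2 * q x + 2 * t * r + q y" for t
  proof -
    have "0 \<le> q (t *\<^sub>R u + y)"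
      unfolding q_def by (rule positive_op_nonneg[OF A])
    also have "\<dots> = t\<^sup>2 * q u + 2 * t * r + q y"
      using u u' unfolding q_def
      by (simp add: lin cinner.add_left cinner.add_right cinner.scaleR_left cinner.scaleR_right
          power2_eq_square algebra_simps)
    finally show ?thesis by (simp add: qu)
  qed
  have q: "q x \<ge> 0" "q y \<ge> 0"
    unfolding q_def by (rule positive_op_nonneg[OF A])+
  have "r\<^sup>2 \<le> q x * q y"
  proof (cases "q x = 0")
    case True
    have "r = 0"
    proof (rule ccontr)
      assume "r \<noteq> 0"
      \<comment> \<open>With \<open>q x = 0\<close> the polynomial is affine in \<open>t\<close>;
        this \<open>t\<close> gives it the value -1.\<close>
      then have "2 * (- (q y + 1) / (2 * r)) * r = - (q y + 1)"
        by simp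
      then show False
        using quad[of "- (q y + 1) / (2 * r)"] unfolding True mult_zero_right by linarith
    qed
    then show ?thesis using q by simp
  next
    case False
    then have "0 < q x" using q by simp
    \<comment> \<open>The chosen \<open>t\<close> is the vertex of the parabola.\<close>
    then show ?thesis
      using quad[of "- r / q x"] by (simp add: power2_eq_square field_simps)
  qed
  then show ?thesis
    by (simp add: q_def r_def)
qed

text \<open>This is the operator inequality A^2 <= A for 0 <= A <= 1, from Cauchy-Schwarz for the
  form of \<open>A\<close> at the vectors \<open>x\<close> and \<open>A x\<close>.\<close>

lemma positive_op_contraction:
  assumes A: "positive_op A" and le: "\<And>x. Re (cinner (A x) x) \<le> (norm x)\<^sup>2"
  shows "(norm (A x))\<^sup>2 \<le> Re (cinner (A x) x)"
proof -
  let ?n = "(norm (A x))\<^sup>2" and ?q = "Re (cinner (A x) x)"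
  have "?n * ?n = (norm (cinner (A x) (A x)))\<^sup>2"
    unfolding cinner_self norm_of_real by (simp add: power2_eq_square)
  also have "\<dots> \<le> ?q * Re (cinner (A (A x)) (A x))"
    by (rule positive_op_cauchy_schwarz[OF A])
  also have "\<dots> \<le> ?q * ?n"
    by (intro mult_left_mono le positive_op_nonneg[OF A])
  finally show ?thesis
    using positive_op_nonneg[OF A, of x] mult_le_cancel_right[of ?n ?n ?q] zero_le_power2[of "norm (A x)"]
    by linarith
qed

lemma positive_op_contraction_norm:
  assumes A: "positive_op A" and le: "\<And>x. Re (cinner (A x) x) \<le> (norm x)\<^sup>2"
  shows "norm (A x) \<le> norm x"
  using order_trans[OF positive_op_contraction[OF assms] le] by (rule power2_le_imp_le) simp

lemma positive_op_kernel:
  assumes "positive_op A" "Re (cinner (A x) x) = 0"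
  shows "A x = 0"
proof -
  have "(norm (cinner (A x) (A x)))\<^sup>2 \<le> 0"
    using positive_op_cauchy_schwarz[OF assms(1), of x "A x"] assms(2) by simp
  then show ?thesis by (simp add: cinner_self)
qed

lemma positive_op_scaleR:
  assumes "positive_op A" "0 \<le> r"
  shows "positive_op (\<lambda>x. r *\<^sub>R A x)"
  using assms unfolding positive_op_def
  by (auto intro: bounded_clinear_scaleR simp: cinner.scaleR_left scaleR_conv_of_real)

lemma positive_op_bound:
  assumes "positive_op A"
  obtains c where "c > 0" "\<And>x. Re (cinner (A x) x) \<le> c * (norm x)\<^sup>2"
proof -
  obtain K where K: "K > 0" "\<And>x. norm (A x) \<le> K * norm x"
    using bounded_clinear_bound[OF positive_op_bounded_clinear[OF assms]] by blast
  have "Re (cinner (A x) x) \<le> K * (norm x)\<^sup>2" for x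
    using Re_cinner_le[of "A x" x] mult_right_mono[OF K(2), of "norm x" x]
    by (simp add: power2_eq_square mult_ac)
  then show ?thesis using that K(1) by blast
qed

section \<open>Limits of operator sequences in the strong topology\<close>

lemma bounded_clinear_limit:
  assumes T: "\<And>n. bounded_clinear (T n)" and lim: "\<And>x. (\<lambda>n. T n x) \<longlonglongrightarrow> L x"
    and bd: "\<And>n x. norm (T n x) \<le> K * norm x"
  shows "bounded_clinear L"
proof (rule bounded_clinearI)
  show "L (x + y) = L x + L y" for x y
    using tendsto_add[OF lim[of x] lim[of y]]
    by (intro LIMSEQ_unique[OF lim]) (simp add: linear_simps[OF bounded_clinear_bounded_linear[OF T]])
  show "L (a *\<^sub>C x) = a *\<^sub>C L x" for a x
    using scaleC.tendsto[OF tendsto_const lim[of x], of a]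
    by (intro LIMSEQ_unique[OF lim]) (simp add: bounded_clinear_scaleC[OF T])
  show "norm (L x) \<le> K * norm x" for x
    using tendsto_norm[OF lim[of x]] by (rule LIMSEQ_le_const2) (use bd in blast)
qed

text \<open>The uniform norm bound absorbs the difference between the moving argument
  \<open>x n\<close> and its limit. This lets products of strongly convergent iterates
  converge.\<close>

lemma tendsto_uniformly_bounded:
  assumes T: "\<And>n. bounded_clinear (T n)" and lim: "(\<lambda>n. T n l) \<longlonglongrightarrow> m"
    and bd: "\<And>n x. norm (T n x) \<le> K * norm x" and x: "x \<longlonglongrightarrow> l"
  shows "(\<lambda>n. T n (x n)) \<longlonglongrightarrow> m"
proof -
  have "(\<lambda>n. T n (x n - l)) \<longlonglongrightarrow> 0"
  proof (rule Lim_null_comparison)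
    show "\<forall>\<^sub>F n in sequentially. norm (T n (x n - l)) \<le> K * norm (x n - l)"
      using bd by simp
    show "(\<lambda>n. K * norm (x n - l)) \<longlonglongrightarrow> 0"
      using tendsto_mult_right_zero[OF tendsto_norm_zero[OF LIM_zero[OF x]]] .
  qed
  from tendsto_add[OF this lim] show ?thesis
    by (simp add: linear_simps[OF bounded_clinear_bounded_linear[OF T]])
qed

section \<open>Convergence of the square root iteration\<close>

lemma summable_telescope_convergent:
  fixes f :: "nat \<Rightarrow> 'a::real_normed_vector"
  shows "summable (\<lambda>n. f (Suc n) - f n) \<longleftrightarrow> convergent f"
  using convergent_add_const_iff[of "- f 0" f]
  by (simp add: summable_iff_convergent sum_lessThan_telescope)

text \<open>Majorises the operator iteration \<open>Y \<mapsto> (B + Y\<^sup>2) / 2\<close>, whose fixed point is \<open>1 - sqrt (1 - B)\<close>.\<close>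

fun sqrt_majorant :: "nat \<Rightarrow> real" where
  "sqrt_majorant 0 = 0"
| "sqrt_majorant (Suc n) = (1 + (sqrt_majorant n)\<^sup>2) / 2"

lemma sqrt_majorant_bounds: "0 \<le> sqrt_majorant n \<and> sqrt_majorant n \<le> 1"
  by (induction n) (auto simp: power_le_one)

lemma sqrt_majorant_mono: "sqrt_majorant n \<le> sqrt_majorant (Suc n)"
  using zero_le_power2[of "sqrt_majorant n - 1"] by (simp add: power2_eq_square algebra_simps)

lemma sqrt_majorant_convergent: "convergent sqrt_majorant"
proof (rule Bseq_mono_convergent)
  show "Bseq sqrt_majorant"
    using sqrt_majorant_bounds by (intro BseqI'[of _ 1]) simp
  show "\<forall>m n. m \<le> n \<longrightarrow> sqrt_majorant m \<le> sqrt_majorant n"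
    using sqrt_majorant_mono by (metis lift_Suc_mono_le)
qed

text \<open>For linear \<open>B\<close> every iterate is a polynomial in \<open>B\<close>, so
  symmetry and commutation relations of \<open>B\<close> pass to all iterates and then to their
  limit.\<close>

fun sqrt_iter :: "('h::chilbert_space \<Rightarrow> 'h) \<Rightarrow> nat \<Rightarrow> 'h \<Rightarrow> 'h" where
  "sqrt_iter B 0 x = 0"
| "sqrt_iter B (Suc n) x = (1/2) *\<^sub>R (B x + sqrt_iter B n (sqrt_iter B n x))"

lemma sqrt_iter_bounded_clinear:
  assumes "bounded_clinear B"
  shows "bounded_clinear (sqrt_iter B n)"
proof (induction n)
  case 0
  have "sqrt_iter B 0 = (\<lambda>x. 0)"
    by (rule ext) simp
  then show ?case using bounded_clinear_zero by simp
next
  case (Suc n)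
  have "sqrt_iter B (Suc n) = (\<lambda>x. (1/2) *\<^sub>R (B x + sqrt_iter B n (sqrt_iter B n x)))"
    by (rule ext) simp
  then show ?case
    using Suc assms
    by (auto intro!: bounded_clinear_scaleR bounded_clinear_add bounded_clinear_compose[of "sqrt_iter B n"])
qed

lemma norm_sqrt_iter:
  assumes "\<And>x. norm (B x) \<le> norm x"
  shows "norm (sqrt_iter B n x) \<le> sqrt_majorant n * norm x"
proof (induction n arbitrary: x)
  case (Suc n)
  have "norm (B x + sqrt_iter B n (sqrt_iter B n x))
      \<le> norm x + sqrt_majorant n * (sqrt_majorant n * norm x)"
  proof (rule norm_triangle_mono[OF assms])
    show "norm (sqrt_iter B n (sqrt_iter B n x)) \<le> sqrt_majorant n * (sqrt_majorant n * norm x)"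
      using Suc[of "sqrt_iter B n x"] mult_left_mono[OF Suc[of x], of "sqrt_majorant n"]
        sqrt_majorant_bounds[of n] by linarith
  qed
  then show ?case
    unfolding sqrt_iter.simps norm_scaleR by (simp add: power2_eq_square algebra_simps)
qed simp

text \<open>Consecutive squares differ by \<open>Y' (Y' - Y) + (Y' - Y) Y\<close>; bounding each
  factor reproduces the same identity for the majorant. The increments of the majorant are summable,
  so the iterates converge.\<close>

lemma norm_sqrt_iter_diff:
  assumes B: "bounded_clinear B" and contr: "\<And>x. norm (B x) \<le> norm x"
  shows "norm (sqrt_iter B (Suc n) x - sqrt_iter B n x)
    \<le> (sqrt_majorant (Suc n) - sqrt_majorant n) * norm x"
proof (induction n arbitrary: x)
  case 0
  then show ?case using contr[of x] by simp
next
  case (Suc n)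
  let ?Y' = "sqrt_iter B (Suc n)" and ?Y = "sqrt_iter B n"
  let ?y' = "sqrt_majorant (Suc n)" and ?y = "sqrt_majorant n"
  have lin: "?Y' (u - v) = ?Y' u - ?Y' v" for u v
    using linear_simps(2)[OF bounded_clinear_bounded_linear[OF sqrt_iter_bounded_clinear[OF B]]] .
  have y: "0 \<le> ?y'" "0 \<le> ?y' - ?y"
    using sqrt_majorant_bounds sqrt_majorant_mono by (auto simp: le_diff_eq simp del: sqrt_majorant.simps)
  have "sqrt_iter B (Suc (Suc n)) x - ?Y' x = (1/2) *\<^sub>R (?Y' (?Y' x - ?Y x) + (?Y' (?Y x) - ?Y (?Y x)))"
    unfolding lin by (simp only: sqrt_iter.simps(2)[of B "Suc n"] sqrt_iter.simps(2)[of B n x])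
      (simp only: scaleR_add_right scaleR_diff_right algebra_simps)
  then have "norm (sqrt_iter B (Suc (Suc n)) x - ?Y' x)
      \<le> (1/2) * (norm (?Y' (?Y' x - ?Y x)) + norm (?Y' (?Y x) - ?Y (?Y x)))"
    using norm_triangle_ineq[of "?Y' (?Y' x - ?Y x)" "?Y' (?Y x) - ?Y (?Y x)"]
    by (simp del: sqrt_iter.simps)
  also have "norm (?Y' (?Y' x - ?Y x)) \<le> ?y' * ((?y' - ?y) * norm x)"
    using norm_sqrt_iter[OF contr, of "Suc n" "?Y' x - ?Y x"] mult_left_mono[OF Suc[of x] y(1)]
    by linarith
  also have "norm (?Y' (?Y x) - ?Y (?Y x)) \<le> (?y' - ?y) * (?y * norm x)"
    using Suc[of "?Y x"] mult_left_mono[OF norm_sqrt_iter[OF contr, of n x] y(2)] by linarith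
  also have "(1/2) * (?y' * ((?y' - ?y) * norm x) + (?y' - ?y) * (?y * norm x))
      = (sqrt_majorant (Suc (Suc n)) - ?y') * norm x"
  proof -
    have "(1/2) * (a * ((a - b) * m) + (a - b) * (b * m)) = ((1 + a\<^sup>2) / 2 - a) * m"
      if "a = (1 + b\<^sup>2) / 2" for a b m :: real
    proof -
      have "(1 + a\<^sup>2) / 2 - a = (a\<^sup>2 - b\<^sup>2) / 2"
        using that by (simp add: field_simps)
      then show ?thesis
        by (simp only:) (simp add: power2_eq_square algebra_simps)
    qed
    from this[OF sqrt_majorant.simps(2)] show ?thesis
      by (simp only: sqrt_majorant.simps(2)[of "Suc n"])
  qed
  finally show ?case by simp
qed

lemma sqrt_iter_convergent:
  assumes B: "bounded_clinear B" and contr: "\<And>x. norm (B x) \<le> norm x"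
  shows "convergent (\<lambda>n. sqrt_iter B n x)"
proof -
  have "summable (\<lambda>n. (sqrt_majorant (Suc n) - sqrt_majorant n) * norm x)"
    using sqrt_majorant_convergent
    by (intro summable_mult2) (simp only: summable_telescope_convergent)
  then have "summable (\<lambda>n. sqrt_iter B (Suc n) x - sqrt_iter B n x)"
    by (rule summable_comparison_test'[where N = 0]) (rule norm_sqrt_iter_diff[OF assms])
  then show ?thesis
    by (simp only: summable_telescope_convergent[of "\<lambda>n. sqrt_iter B n x"])
qed

text \<open>With \<open>B = 1 - A\<close> the limit \<open>Z\<close> of the iteration satisfies 2 Z
  = B + Z^2, so \<open>R = 1 - Z\<close> squares to \<open>A\<close>. The clause on commuting
  operators is recorded because the uniqueness proof depends on it.\<close>

lemma positive_sqrt_contraction: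
  assumes A: "positive_op A" and le: "\<And>x. Re (cinner (A x) x) \<le> (norm x)\<^sup>2"
  shows "\<exists>R. positive_op R \<and> (\<forall>x. R (R x) = A x) \<and>
    (\<forall>C. bounded_clinear C \<longrightarrow> (\<forall>x. A (C x) = C (A x)) \<longrightarrow> (\<forall>x. R (C x) = C (R x)))"
proof -
  define B where "B x = x - A x" for x
  have B: "bounded_clinear B"
    unfolding B_def[abs_def]
    by (intro bounded_clinear_diff bounded_clinear_id positive_op_bounded_clinear[OF A])
  have Bherm: "cinner (B x) y = cinner x (B y)" for x y
    by (simp add: B_def cinner.diff_left cinner.diff_right positive_op_hermitian[OF A])
  have BRe: "Re (cinner (B x) x) = (norm x)\<^sup>2 - Re (cinner (A x) x)" for x
    by (simp add: B_def cinner.diff_left Re_cinner_self)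
  have "positive_op B"
    using B le hermitian_cinner_Reals[OF Bherm] unfolding positive_op_def by (simp add: BRe)
  then have contr: "norm (B x) \<le> norm x" for x
    by (rule positive_op_contraction_norm) (simp add: BRe positive_op_nonneg[OF A])
  let ?Y = "sqrt_iter B"
  obtain Z where Z: "\<And>x. (\<lambda>n. ?Y n x) \<longlonglongrightarrow> Z x"
    using sqrt_iter_convergent[OF B contr] unfolding convergent_def by metis
  have Y: "bounded_clinear (?Y n)" for n
    by (rule sqrt_iter_bounded_clinear[OF B])
  have Ybd: "norm (?Y n x) \<le> 1 * norm x" for n x
    using norm_sqrt_iter[OF contr, of n x] mult_right_mono[of "sqrt_majorant n" 1 "norm x"]
      sqrt_majorant_bounds[of n] by simp
  have Zb: "bounded_clinear Z"
    by (rule bounded_clinear_limit[OF Y Z Ybd])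
  have Znorm: "norm (Z x) \<le> norm x" for x
    using tendsto_norm[OF Z[of x]] by (rule LIMSEQ_le_const2) (use Ybd in auto)
  have ZZ: "(\<lambda>n. ?Y n (?Y n x)) \<longlonglongrightarrow> Z (Z x)" for x
    by (rule tendsto_uniformly_bounded[OF Y Z Ybd Z])
  have fix_eq: "Z x = (1/2) *\<^sub>R (B x + Z (Z x))" for x
  proof (rule LIMSEQ_unique)
    show "(\<lambda>n. ?Y (Suc n) x) \<longlonglongrightarrow> Z x"
      by (rule LIMSEQ_Suc[OF Z])
    show "(\<lambda>n. ?Y (Suc n) x) \<longlonglongrightarrow> (1/2) *\<^sub>R (B x + Z (Z x))"
      unfolding sqrt_iter.simps by (intro tendsto_intros ZZ)
  qed
  have Yherm: "cinner (?Y n x) y = cinner x (?Y n y)" for n x y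
    by (induction n arbitrary: x y)
       (simp_all add: cinner.scaleR_left cinner.scaleR_right cinner_add_left cinner_add_right cinner.zero_left cinner.zero_right Bherm)
  have Zherm: "cinner (Z x) y = cinner x (Z y)" for x y
    using cinner.tendsto[OF Z[of x] tendsto_const] cinner.tendsto[OF tendsto_const Z[of y]]
    unfolding Yherm by (rule LIMSEQ_unique)
  define R where "R x = x - Z x" for x
  have Rherm: "cinner (R x) y = cinner x (R y)" for x y
    by (simp add: R_def cinner.diff_left cinner.diff_right Zherm)
  have "positive_op R"
    unfolding positive_op_def
  proof (intro conjI allI)
    show "bounded_clinear R"
      unfolding R_def[abs_def] by (intro bounded_clinear_diff bounded_clinear_id Zb)
    show "cinner (R x) x \<in> \<real>" for x
      by (rule hermitian_cinner_Reals[OF Rherm])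
    show "0 \<le> Re (cinner (R x) x)" for x
      using Re_cinner_le[of "Z x" x] mult_right_mono[OF Znorm[of x], of "norm x"]
      by (simp add: R_def cinner.diff_left Re_cinner_self power2_eq_square)
  qed
  moreover have "R (R x) = A x" for x
  proof -
    have "Z x + Z x = B x + Z (Z x)"
      using arg_cong[OF fix_eq[of x], of "\<lambda>v. v + v"] by (simp add: scaleR_add_left[symmetric])
    then show ?thesis
      by (simp add: R_def B_def linear_simps[OF bounded_clinear_bounded_linear[OF Zb]] algebra_simps)
  qed
  moreover have "R (C x) = C (R x)" if C: "bounded_clinear C" "\<forall>x. A (C x) = C (A x)" for C x
  proof -
    note lin = linear_simps[OF bounded_clinear_bounded_linear[OF C(1)]]
    have "?Y n (C x) = C (?Y n x)" for n x
      using C(2) by (induction n arbitrary: x) (simp_all add: lin B_def)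
    then have "(\<lambda>n. C (?Y n x)) \<longlonglongrightarrow> Z (C x)"
      using Z[of "C x"] by simp
    then have "Z (C x) = C (Z x)"
      using bounded_clinear_tendsto[OF C(1) Z[of x]] LIMSEQ_unique by blast
    then show ?thesis by (simp add: R_def lin)
  qed
  ultimately show ?thesis by blast
qed

text \<open>Dividing by a bound \<open>c\<close> of the quadratic form reduces to the contractive
  case; the root is then scaled back by \<open>sqrt c\<close>.\<close>

lemma positive_sqrt_commuting:
  assumes A: "positive_op A"
  shows "\<exists>R. positive_op R \<and> (\<forall>x. R (R x) = A x) \<and>
    (\<forall>C. bounded_clinear C \<longrightarrow> (\<forall>x. A (C x) = C (A x)) \<longrightarrow> (\<forall>x. R (C x) = C (R x)))"
proof -
  obtain c where c: "c > 0" "\<And>x. Re (cinner (A x) x) \<le> c * (norm x)\<^sup>2"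
    using positive_op_bound[OF A] by blast
  have "positive_op (\<lambda>x. (1/c) *\<^sub>R A x)"
    using A c by (intro positive_op_scaleR) auto
  moreover have "Re (cinner ((1/c) *\<^sub>R A x) x) \<le> (norm x)\<^sup>2" for x
    using c(1) c(2)[of x] by (simp add: cinner.scaleR_left field_simps)
  ultimately obtain R where R: "positive_op R" "\<And>x. R (R x) = (1/c) *\<^sub>R A x"
    and comm: "\<And>C x. bounded_clinear C \<Longrightarrow> (\<forall>x. (1/c) *\<^sub>R A (C x) = C ((1/c) *\<^sub>R A x)) \<Longrightarrow> R (C x) = C (R x)"
    using positive_sqrt_contraction[of "\<lambda>x. (1/c) *\<^sub>R A x"] by auto
  have "positive_op (\<lambda>x. sqrt c *\<^sub>R R x)"
    using R c by (intro positive_op_scaleR) auto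
  moreover have "sqrt c *\<^sub>R R (sqrt c *\<^sub>R R x) = A x" for x
    using R(2)[of x] c(1)
    by (simp add: linear_simps[OF bounded_clinear_bounded_linear[OF positive_op_bounded_clinear[OF R(1)]]])
  moreover have "sqrt c *\<^sub>R R (C x) = C (sqrt c *\<^sub>R R x)"
    if "bounded_clinear C" "\<forall>x. A (C x) = C (A x)" for C x
    using that comm[OF that(1), of x] by (simp add: linear_simps[OF bounded_clinear_bounded_linear[OF that(1)]])
  ultimately show ?thesis
    by (intro exI[of _ "\<lambda>x. sqrt c *\<^sub>R R x"]) blast
qed

lemma positive_op_square:
  assumes "positive_op P"
  shows "positive_op (\<lambda>x. P (P x))"
  using assms unfolding positive_op_def
  by (auto simp: positive_op_hermitian[OF assms] Re_cinner_self cinner_self intro: bounded_clinear_compose)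

text \<open>Both roots are compared with the root \<open>R\<close> constructed from their common
  square: any root commutes with that square, hence with \<open>R\<close>, which permits factoring a
  difference of squares.\<close>

lemma positive_sqrt_unique:
  assumes P: "positive_op P" and Q: "positive_op Q" and eq: "\<And>x. P (P x) = Q (Q x)"
  shows "P = Q"
proof -
  define A where "A x = Q (Q x)" for x
  have "positive_op A"
    unfolding A_def[abs_def] by (rule positive_op_square[OF Q])
  then obtain R where R: "positive_op R" "\<And>x. R (R x) = A x"
    and comm: "\<And>C x. bounded_clinear C \<Longrightarrow> (\<forall>x. A (C x) = C (A x)) \<Longrightarrow> R (C x) = C (R x)"
    using positive_sqrt_commuting[of A] by blast
  have uniq: "S x = R x" if S: "positive_op S" "\<And>x. S (S x) = A x" for S x
  proof -
    note linS = linear_simps[OF bounded_clinear_bounded_linear[OF positive_op_bounded_clinear[OF S(1)]]]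
    note linR = linear_simps[OF bounded_clinear_bounded_linear[OF positive_op_bounded_clinear[OF R(1)]]]
    have RS: "R (S x) = S (R x)" for x
      using comm[OF positive_op_bounded_clinear[OF S(1)]] S(2) by metis
    let ?y = "R x - S x"
    \<comment> \<open>This is (R + S)(R - S) x = R^2 x - S^2 x, expanded using that \<open>R\<close>
      and \<open>S\<close> commute. Positivity then forces each of them to annihilate
      \<open>?y\<close>.\<close>
    have "R ?y + S ?y = 0"
      by (simp add: linS linR RS R(2) S(2))
    then have "cinner (R ?y) ?y + cinner (S ?y) ?y = 0"
      by (simp add: cinner_add_left[symmetric] cinner.zero_left)
    then have "Re (cinner (R ?y) ?y) + Re (cinner (S ?y) ?y) = 0"
      by (metis plus_complex.sel(1) zero_complex.sel(1))
    then have "Re (cinner (R ?y) ?y) = 0" "Re (cinner (S ?y) ?y) = 0"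
      using positive_op_nonneg[OF R(1), of ?y] positive_op_nonneg[OF S(1), of ?y] by linarith+
    then have "R ?y = 0" "S ?y = 0"
      using positive_op_kernel R(1) S(1) by blast+
    then have "cinner ?y ?y = 0"
      by (simp add: cinner.diff_left positive_op_hermitian[OF R(1)] positive_op_hermitian[OF S(1)]
          cinner.zero_right)
    then show ?thesis by (simp add: cinner_self)
  qed
  show ?thesis
  proof
    show "P x = Q x" for x
      using uniq[OF P eq[folded A_def], of x] uniq[OF Q A_def[symmetric], of x] by simp
  qed
qed

section \<open>The absolute value of an operator\<close>

lemma positive_cadjoint_comp:
  assumes "bounded_clinear T"
  shows "positive_op (\<lambda>x. cadjoint T (T x))"
  using assms unfolding positive_op_def
  by (auto simp: cinner_cadjoint'[OF assms, symmetric] Re_cinner_self cinner_self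
      intro: bounded_clinear_compose bounded_clinear_cadjoint)

lemma abs_op_eqI:
  assumes "positive_op A" "\<And>x. A (A x) = cadjoint T (T x)"
  shows "abs_op T = A"
  unfolding abs_op_def
proof (rule the_equality)
  fix B assume "positive_op B \<and> B \<circ> B = cadjoint T \<circ> T"
  then show "B = A"
    using assms by (intro positive_sqrt_unique) (auto simp: fun_eq_iff)
qed (use assms in auto)

lemma
  assumes "bounded_clinear T"
  shows positive_abs_op: "positive_op (abs_op T)"
    and abs_op_square: "abs_op T (abs_op T x) = cadjoint T (T x)"
proof -
  obtain R where R: "positive_op R" "\<And>x. R (R x) = cadjoint T (T x)"
    using positive_sqrt_commuting[OF positive_cadjoint_comp[OF assms]] by blast
  then have "abs_op T = R" by (rule abs_op_eqI)
  then show "positive_op (abs_op T)" "abs_op T (abs_op T x) = cadjoint T (T x)"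
    using R by simp_all
qed

lemma norm_abs_op:
  assumes "bounded_clinear T"
  shows "norm (abs_op T x) = norm (T x)"
proof -
  have "(norm (abs_op T x))\<^sup>2 = (norm (T x))\<^sup>2"
    unfolding Re_cinner_self[symmetric]
    by (simp add: positive_op_hermitian[OF positive_abs_op[OF assms]] abs_op_square[OF assms]
        cinner_cadjoint[OF assms])
  then show ?thesis by (simp add: power2_eq_iff_nonneg)
qed

lemma abs_op_positive:
  assumes "positive_op P"
  shows "abs_op P = P"
proof -
  have "cadjoint P = P"
    by (rule cadjoint_eqI) (rule positive_op_hermitian[OF assms])
  then show ?thesis
    by (intro abs_op_eqI[OF assms]) simp
qed

text \<open>Because R^2 <= R, the step from \<open>v n\<close> to \<open>v (Suc n)\<close> lowers
  the squared norm by at least \<open>(norm (R (v n)))^2\<close>. A decreasing nonnegative sequence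
  has vanishing steps.\<close>

lemma contraction_powers_vanish:
  assumes R: "positive_op R" and le: "\<And>x. Re (cinner (R x) x) \<le> (norm x)\<^sup>2"
  shows "(\<lambda>n. R (((\<lambda>x. x - R x) ^^ n) x)) \<longlonglongrightarrow> 0"
proof -
  define v where "v n = ((\<lambda>x. x - R x) ^^ n) x" for n
  have step: "(norm (R (v n)))\<^sup>2 \<le> (norm (v n))\<^sup>2 - (norm (v (Suc n)))\<^sup>2" for n
  proof -
    have "(norm (v (Suc n)))\<^sup>2 = (norm (v n))\<^sup>2 - 2 * Re (cinner (R (v n)) (v n)) + (norm (R (v n)))\<^sup>2"
      by (simp add: v_def power2_norm_eq_inner inner_diff_left inner_diff_right inner_commute
          inner_cinner[symmetric])
    then show ?thesis
      using positive_op_contraction[OF assms, of "v n"] by linarith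
  qed
  have "convergent (\<lambda>n. (norm (v n))\<^sup>2)"
  proof -
    have "decseq (\<lambda>n. (norm (v n))\<^sup>2)"
      using step by (intro decseq_SucI) (smt (verit) zero_le_power2)
    then show ?thesis
      using decseq_convergent[of "\<lambda>n. (norm (v n))\<^sup>2" 0] unfolding convergent_def by (metis zero_le_power2)
  qed
  then obtain l where l: "(\<lambda>n. (norm (v n))\<^sup>2) \<longlonglongrightarrow> l"
    unfolding convergent_def by blast
  have "(\<lambda>n. (norm (R (v n)))\<^sup>2) \<longlonglongrightarrow> 0"
  proof (rule tendsto_sandwich[OF _ _ tendsto_const])
    show "(\<lambda>n. (norm (v n))\<^sup>2 - (norm (v (Suc n)))\<^sup>2) \<longlonglongrightarrow> 0"
      using tendsto_diff[OF l LIMSEQ_Suc[OF l]] by simp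
  qed (use step in auto)
  then have "(\<lambda>n. norm (R (v n))) \<longlonglongrightarrow> 0"
    using tendsto_real_sqrt by fastforce
  then show ?thesis
    unfolding v_def by (rule tendsto_norm_zero_cancel)
qed

text \<open>\<open>A\<close> is the strong limit of \<open>T \<circ> (\<Sum>k<n. (1 - R)\<^sup>k)\<close>, so no continuous extension from the range of \<open>R\<close> is needed.\<close>

lemma factor_through_positive_contraction:
  assumes R: "positive_op R" and le: "\<And>x. Re (cinner (R x) x) \<le> (norm x)\<^sup>2"
    and T: "bounded_clinear T" and TR: "\<And>x. norm (T x) = norm (R (R x))"
  shows "\<exists>A. bounded_clinear A \<and> (\<forall>x. A (R x) = T x) \<and> (\<forall>x. norm (A x) = norm (R x))"
proof -
  define V where "V x = x - R x" for x
  define S where "S n x = (\<Sum>k<n. (V ^^ k) x)" for n x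
  note Rb = positive_op_bounded_clinear[OF R]
  note linR = linear_simps[OF bounded_clinear_bounded_linear[OF Rb]]
  note linT = linear_simps[OF bounded_clinear_bounded_linear[OF T]]
  have Vb: "bounded_clinear V"
    unfolding V_def[abs_def] by (intro bounded_clinear_diff bounded_clinear_id Rb)
  have Vn: "bounded_clinear (V ^^ n)" for n
    by (rule bounded_clinear_funpow[OF Vb])
  have Sb: "bounded_clinear (S n)" for n
    unfolding S_def[abs_def] by (intro bounded_clinear_sum Vn)
  have telescope: "(\<Sum>k<n. (V ^^ k) x - V ((V ^^ k) x)) = x - (V ^^ n) x" for n x
    using sum_lessThan_telescope'[of "\<lambda>k. (V ^^ k) x" n] by simp
  \<comment> \<open>As \<open>R = 1 - V\<close>, the geometric sum \<open>S n\<close> is an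
    approximate inverse of \<open>R\<close> on either side, with error
    \<open>V ^^ n\<close>.\<close>
  have RS: "R (S n x) = x - (V ^^ n) x" for n x
  proof -
    have "R (S n x) = (\<Sum>k<n. (V ^^ k) x - V ((V ^^ k) x))"
      unfolding S_def bounded_linear.linear[OF bounded_clinear_bounded_linear[OF Rb], THEN linear_sum]
      by (simp add: V_def)
    then show ?thesis by (simp only: telescope)
  qed
  have SR: "S n (R x) = x - (V ^^ n) x" for n x
  proof -
    have "R x = x - V x" by (simp add: V_def)
    then have "S n (R x) = (\<Sum>k<n. (V ^^ k) x - V ((V ^^ k) x))"
      unfolding S_def
      by (simp add: linear_simps(2)[OF bounded_clinear_bounded_linear[OF Vn]] funpow_swap1)
    then show ?thesis by (simp only: telescope)
  qed
  have van: "(\<lambda>n. R ((V ^^ n) x)) \<longlonglongrightarrow> 0" for x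
    using contraction_powers_vanish[OF R le, of x] unfolding V_def[abs_def] .
  have norm_TS: "norm (T (S n x)) = norm (R x - R ((V ^^ n) x))" for n x
    by (simp add: TR RS linR)
  have "convergent (\<lambda>n. T (S n x))" for x
  proof -
    \<comment> \<open>By \<open>TR\<close>, distances between the \<open>T (S n x)\<close> are
      distances between the \<open>R (R (S n x))\<close>, where only the vanishing term depends on
      \<open>n\<close>.\<close>
    have "dist (T (S m x)) (T (S n x)) = dist (R ((V ^^ m) x)) (R ((V ^^ n) x))" for m n
    proof -
      have "dist (T (S m x)) (T (S n x)) = norm (R (R (S m x) - R (S n x)))"
        by (simp add: dist_norm linT(2)[symmetric] linR(2)[symmetric] TR)
      also have "\<dots> = dist (R ((V ^^ n) x)) (R ((V ^^ m) x))"
        by (simp add: RS dist_norm linR)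
      finally show ?thesis by (simp add: dist_commute)
    qed
    moreover have "Cauchy (\<lambda>n. R ((V ^^ n) x))"
      by (rule LIMSEQ_imp_Cauchy[OF van])
    ultimately have "Cauchy (\<lambda>n. T (S n x))"
      unfolding Cauchy_def by simp
    then show ?thesis by (rule Cauchy_convergent)
  qed
  then obtain A where A: "\<And>x. (\<lambda>n. T (S n x)) \<longlonglongrightarrow> A x"
    unfolding convergent_def by metis
  have contrR: "norm (R x) \<le> norm x" for x
    by (rule positive_op_contraction_norm[OF R le])
  have "norm (V x) \<le> norm x" for x
  proof -
    have "positive_op V"
      using Vb le unfolding positive_op_def
      by (auto simp: V_def cinner.diff_left Re_cinner_self hermitian_cinner_Reals[OF positive_op_hermitian[OF R]] cinner_self)
    then show ?thesis
      by (rule positive_op_contraction_norm)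
         (simp add: V_def cinner.diff_left Re_cinner_self positive_op_nonneg[OF R])
  qed
  then have contrV: "norm ((V ^^ n) x) \<le> norm x" for n x
    by (induction n) (auto intro: order_trans)
  have "norm (T (S n x)) \<le> 2 * norm x" for n x
    unfolding norm_TS
    using norm_triangle_ineq4[of "R x" "R ((V ^^ n) x)"] contrR[of x] contrR[of "(V ^^ n) x"] contrV[of n x]
    by linarith
  then have "bounded_clinear A"
    using bounded_clinear_limit[of "\<lambda>n x. T (S n x)", OF bounded_clinear_compose[OF T Sb] A] by blast
  moreover have "A (R x) = T x" for x
  proof -
    have "(\<lambda>n. T ((V ^^ n) x)) \<longlonglongrightarrow> 0"
      using bounded_clinear_tendsto[OF Rb van[of x]]
      by (subst tendsto_norm_zero_iff[symmetric]) (simp add: TR tendsto_norm_zero_iff linR)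
    then have "(\<lambda>n. T (S n (R x))) \<longlonglongrightarrow> T x - 0"
      unfolding SR linT by (intro tendsto_diff tendsto_const)
    then show ?thesis
      using LIMSEQ_unique[OF A[of "R x"]] by simp
  qed
  moreover have "norm (A x) = norm (R x)" for x
  proof -
    have "(\<lambda>n. norm (T (S n x))) \<longlonglongrightarrow> norm (R x - 0)"
      unfolding norm_TS by (intro tendsto_norm tendsto_diff tendsto_const van)
    then show ?thesis
      using LIMSEQ_unique[OF tendsto_norm[OF A[of x]]] by simp
  qed
  ultimately show ?thesis by blast
qed

lemma factor_through_positive:
  assumes R: "positive_op R" and T: "bounded_clinear T" and TR: "\<And>x. norm (T x) = norm (R (R x))"
  shows "\<exists>A. bounded_clinear A \<and> (\<forall>x. A (R x) = T x) \<and> (\<forall>x. norm (A x) = norm (R x))"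
proof -
  obtain c where c: "c > 0" "\<And>x. Re (cinner (R x) x) \<le> c * (norm x)\<^sup>2"
    using positive_op_bound[OF R] by blast
  note linR = linear_simps[OF bounded_clinear_bounded_linear[OF positive_op_bounded_clinear[OF R]]]
  have "positive_op (\<lambda>x. (1/c) *\<^sub>R R x)"
    using R c by (intro positive_op_scaleR) auto
  moreover have "Re (cinner ((1/c) *\<^sub>R R x) x) \<le> (norm x)\<^sup>2" for x
    using c(1) c(2)[of x] by (simp add: cinner.scaleR_left field_simps)
  \<comment> \<open>\<open>R\<close> enters the norm hypothesis twice, so dividing it by
    \<open>c\<close> divides \<open>T\<close> by the square of \<open>c\<close>.\<close>
  moreover have "bounded_clinear (\<lambda>x. (1/c\<^sup>2) *\<^sub>R T x)"
    by (rule bounded_clinear_scaleR[OF T])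
  moreover have "norm ((1/c\<^sup>2) *\<^sub>R T x) = norm ((1/c) *\<^sub>R R ((1/c) *\<^sub>R R x))" for x
    using c(1) by (simp add: TR linR power2_eq_square)
  ultimately obtain A where A: "bounded_clinear A" "\<And>x. A ((1/c) *\<^sub>R R x) = (1/c\<^sup>2) *\<^sub>R T x"
      "\<And>x. norm (A x) = norm ((1/c) *\<^sub>R R x)"
    using factor_through_positive_contraction[of "\<lambda>x. (1/c) *\<^sub>R R x" "\<lambda>x. (1/c\<^sup>2) *\<^sub>R T x"] by blast
  have "c *\<^sub>R A (R x) = T x" for x
  proof -
    have "c *\<^sub>R A (R x) = c\<^sup>2 *\<^sub>R A ((1/c) *\<^sub>R R x)"
      using c(1) by (simp add: linear_simps[OF bounded_clinear_bounded_linear[OF A(1)]] power2_eq_square)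
    then show ?thesis
      using c(1) by (simp only: A(2)) simp
  qed
  moreover have "norm (c *\<^sub>R A x) = norm (R x)" for x
    using c(1) by (simp add: A(3))
  moreover have "bounded_clinear (\<lambda>x. c *\<^sub>R A x)"
    by (rule bounded_clinear_scaleR[OF A(1)])
  ultimately show ?thesis
    by (intro exI[of _ "\<lambda>x. c *\<^sub>R A x"]) blast
qed

subsection \<open>Trace class operators\<close>

text \<open>Since \<open>A\<close> and \<open>R\<close> have the same Hilbert-Schmidt norm, expanding \<open>T x = A (R x)\<close> in an orthonormal
  basis \<open>e\<close> gives \<open>T x = (\<Sum>e. \<langle>x, R e\<rangle> A e)\<close> with \<open>(\<Sum>e. \<parallel>R e\<parallel>\<^sup>2) = (\<Sum>e. \<parallel>A e\<parallel>\<^sup>2) = \<parallel>T\<parallel>\<^sub>1\<close>. This replaces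
  the singular value decomposition.\<close>

lemma trace_class_factorization:
  assumes "trace_class T"
  obtains A R where "bounded_clinear A" "positive_op R" "\<And>x. T x = A (R x)"
    "\<And>x. norm (A x) = norm (R x)" "((\<lambda>e. (norm (R e))\<^sup>2) has_sum trace_norm T) some_onb"
proof -
  have T: "bounded_clinear T" and sm: "(\<lambda>e. cinner (abs_op T e) e) summable_on some_onb"
    using assms by (auto simp: trace_class_def)
  obtain R where R: "positive_op R" "\<And>x. R (R x) = abs_op T x"
    using positive_sqrt_commuting[OF positive_abs_op[OF T]] by blast
  obtain A where A: "bounded_clinear A" "\<And>x. A (R x) = T x" "\<And>x. norm (A x) = norm (R x)"
    using factor_through_positive[OF R(1) T] by (metis R(2) norm_abs_op[OF T])
  have "Re (cinner (abs_op T e) e) = (norm (R e))\<^sup>2" for e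
    by (simp only: R(2)[symmetric] positive_op_hermitian[OF R(1), of "R e" e] Re_cinner_self)
  then have "((\<lambda>e. (norm (R e))\<^sup>2) has_sum trace_norm T) some_onb"
    using has_sum_Re[OF has_sum_infsum[OF sm]] by (simp add: trace_norm_def op_trace_def)
  then show ?thesis
    using A R(1) by (intro that[of A R]) auto
qed

lemma hilbert_schmidt_summable:
  assumes "is_onb E" "(\<lambda>f. (norm (Z f))\<^sup>2) summable_on E"
  shows "(\<lambda>(f, k). (norm (cinner (Z f) k))\<^sup>2) summable_on E \<times> E"
  by (rule summable_on_SigmaI[OF _ assms(2)]) (use parseval[OF assms(1)] in auto)

text \<open>The trace sums diagonal entries of the composition, while square summability is known
  for the images of basis vectors. Expanding in the basis gives one absolutely summable double
  series, and its two orders of summation are the two sides.\<close>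

lemma op_trace_comp_cadjoint:
  fixes Z B :: "'h::chilbert_space \<Rightarrow> 'h"
  assumes Z: "bounded_clinear Z" "(\<lambda>f. (norm (Z f))\<^sup>2) summable_on some_onb"
    and B: "bounded_clinear B" "(\<lambda>f. (norm (B f))\<^sup>2) summable_on some_onb"
  shows "op_trace (Z \<circ> cadjoint B) = (\<Sum>\<^sub>\<infinity>f\<in>some_onb. cinner (Z f) (B f))"
proof -
  let ?E = "some_onb :: 'h set"
  define g where "g f k = cinner (Z f) k * cinner k (B f)" for f k
  have bound: "norm (g f k) \<le> (norm (cinner (Z f) k))\<^sup>2 + (norm (cinner (B f) k))\<^sup>2" for f k
  proof -
    have "norm (g f k) = norm (cinner (Z f) k) * norm (cinner (B f) k)"
      by (simp add: g_def norm_mult norm_cinner_commute[of k])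
    also have "\<dots> \<le> 2 * norm (cinner (Z f) k) * norm (cinner (B f) k)"
      by simp
    also have "\<dots> \<le> (norm (cinner (Z f) k))\<^sup>2 + (norm (cinner (B f) k))\<^sup>2"
      by (rule sum_squares_bound)
    finally show ?thesis .
  qed
  have "(\<lambda>(f, k). g f k) summable_on ?E \<times> ?E"
  proof (rule abs_summable_summable, rule summable_on_comparison_test)
    show "(\<lambda>p. (case p of (f, k) \<Rightarrow> (norm (cinner (Z f) k))\<^sup>2) + (case p of (f, k) \<Rightarrow> (norm (cinner (B f) k))\<^sup>2))
        summable_on ?E \<times> ?E"
      by (intro summable_on_add hilbert_schmidt_summable some_onb Z B)
  qed (use bound in auto)
  then have swap: "(\<Sum>\<^sub>\<infinity>f\<in>?E. \<Sum>\<^sub>\<infinity>k\<in>?E. g f k) = (\<Sum>\<^sub>\<infinity>k\<in>?E. \<Sum>\<^sub>\<infinity>f\<in>?E. g f k)"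
    by (rule infsum_swap_banach)
  have "cinner ((Z \<circ> cadjoint B) k) k = (\<Sum>\<^sub>\<infinity>f\<in>?E. g f k)" for k
  proof -
    have "cinner ((Z \<circ> cadjoint B) k) k = cinner (cadjoint B k) (cadjoint Z k)"
      by (simp add: cinner_cadjoint[OF Z(1)])
    also have "\<dots> = (\<Sum>\<^sub>\<infinity>f\<in>?E. cinner (cadjoint B k) f * cinner f (cadjoint Z k))"
      by (rule infsumI[symmetric]) (rule parseval_cinner[OF some_onb])
    finally show ?thesis
      by (simp add: g_def cinner_cadjoint'[OF B(1), symmetric] cinner_cadjoint[OF Z(1), symmetric] mult.commute)
  qed
  moreover have "(\<Sum>\<^sub>\<infinity>k\<in>?E. g f k) = cinner (Z f) (B f)" for f
    unfolding g_def by (rule infsumI) (rule parseval_cinner[OF some_onb])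
  ultimately show ?thesis
    using swap by (simp add: op_trace_def)
qed

section \<open>Rank one test operators\<close>

definition rank_one :: "'h::chilbert_space \<Rightarrow> 'h \<Rightarrow> 'h" where
  "rank_one \<xi> x = cinner x \<xi> *\<^sub>C \<xi>"

lemma cinner_rank_one: "cinner (rank_one \<xi> x) y = cinner x \<xi> * cinner \<xi> y"
  by (simp add: rank_one_def cinner_scaleC_left)

lemma cinner_mult_commuted: "cinner x y * cinner y x = of_real ((norm (cinner x y))\<^sup>2)"
  by (subst (2) cinner_commute) (simp only: complex_norm_square)

text \<open>Positivity makes the operator its own absolute value, so its trace norm can be read off
  from the diagonal by Parseval.\<close>

lemma positive_rank_one: "positive_op (rank_one \<xi>)"
  unfolding positive_op_def
proof (intro conjI allI)
  show "bounded_clinear (rank_one \<xi>)"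
  proof (rule bounded_clinearI)
    show "norm (rank_one \<xi> x) \<le> (norm \<xi>)\<^sup>2 * norm x" for x
      using mult_right_mono[OF norm_cinner_le[of x \<xi>], of "norm \<xi>"]
      by (simp add: rank_one_def norm_scaleC power2_eq_square mult_ac)
  qed (simp_all add: rank_one_def cinner_add_left cinner_scaleC_left scaleC_add_left scaleC_scaleC)
qed (simp_all add: cinner_rank_one cinner_mult_commuted)

lemma rank_one_has_trace:
  "((\<lambda>e. cinner (abs_op (rank_one \<xi>) e) e) has_sum of_real ((norm \<xi>)\<^sup>2)) some_onb"
  using parseval_cinner[OF some_onb, of \<xi> \<xi>]
  by (simp only: abs_op_positive[OF positive_rank_one] cinner_rank_one cinner_self mult.commute)

lemma trace_class_rank_one: "trace_class (rank_one \<xi>)"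
  unfolding trace_class_def using rank_one_has_trace[of \<xi>]
  by (auto simp: positive_op_bounded_clinear[OF positive_rank_one] summable_on_def)

lemma trace_norm_rank_one: "trace_norm (rank_one \<xi>) = (norm \<xi>)\<^sup>2"
  unfolding trace_norm_def op_trace_def infsumI[OF rank_one_has_trace] by simp

subsection \<open>Matrix coefficients of the conjugation representation\<close>

lemma
  assumes "unitary_rep \<pi>"
  shows unitary_rep_bounded_clinear: "bounded_clinear (\<pi> g)"
    and unitary_rep_cinner: "cinner (\<pi> g x) (\<pi> g y) = cinner x y"
    and unitary_rep_continuous: "continuous_on UNIV (\<lambda>g. \<pi> g x)"
    and unitary_rep_norm: "norm (\<pi> g x) = norm x"
    and unitary_rep_cinner_left: "cinner (\<pi> g x) y = cinner x (\<pi> (- g) y)"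
proof -
  show lin: "bounded_clinear (\<pi> g)" and iso: "cinner (\<pi> g x) (\<pi> g y) = cinner x y"
    and "continuous_on UNIV (\<lambda>g. \<pi> g x)" for g x y
    using assms by (auto simp: unitary_rep_def unitary_op_def)
  show norm: "norm (\<pi> g x) = norm x" for g x
    using iso[of g x x] by (simp only: cinner_self of_real_eq_iff) (simp add: power2_eq_iff_nonneg)
  have hom: "\<pi> (g + h) x = \<pi> g (\<pi> h x)" for g h x
    using assms by (simp add: unitary_rep_def)
  \<comment> \<open>\<open>unitary_rep\<close> only states multiplicativity; the identity element
    acts trivially because \<open>\<pi> 0\<close> is idempotent and isometric.\<close>
  have "\<pi> 0 (\<pi> 0 y - y) = 0"
    by (simp add: linear_simps[OF bounded_clinear_bounded_linear[OF lin]] hom[of 0 0, symmetric])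
  then have one: "\<pi> 0 y = y"
    using norm[of 0 "\<pi> 0 y - y"] by simp
  show "cinner (\<pi> g x) y = cinner x (\<pi> (- g) y)"
    using hom[of g "- g" y] iso[of g x "\<pi> (- g) y"] by (simp add: one)
qed

text \<open>Conjugation carries the rank one operator of a vector to that of its image, and the
  trace of a product of two such operators is the squared modulus of the inner product of their
  vectors.\<close>

lemma hs_inner_rank_one:
  assumes \<pi>: "unitary_rep \<pi>"
  shows "hs_inner (conj_rep \<pi> g (rank_one \<xi>)) (rank_one \<eta>) = of_real ((norm (cinner (\<pi> g \<xi>) \<eta>))\<^sup>2)"
proof -
  have adj: "cadjoint (rank_one \<eta>) = rank_one \<eta>"
    by (rule cadjoint_eqI) (rule positive_op_hermitian[OF positive_rank_one])
  have lin: "\<pi> h (a *\<^sub>C x) = a *\<^sub>C \<pi> h x" for h a x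
    by (rule bounded_clinear_scaleC[OF unitary_rep_bounded_clinear[OF \<pi>]])
  have "cinner ((conj_rep \<pi> g (rank_one \<xi>) \<circ> cadjoint (rank_one \<eta>)) k) k
      = cinner \<eta> (\<pi> g \<xi>) * (cinner (\<pi> g \<xi>) k * cinner k \<eta>)" for k
    by (simp add: adj conj_rep_def rank_one_def lin cinner_scaleC_left
        unitary_rep_cinner_left[OF \<pi>, of "- g" \<eta> \<xi>] mult_ac)
  moreover have "((\<lambda>k. cinner \<eta> (\<pi> g \<xi>) * (cinner (\<pi> g \<xi>) k * cinner k \<eta>)) has_sum
      cinner \<eta> (\<pi> g \<xi>) * cinner (\<pi> g \<xi>) \<eta>) some_onb"
    by (intro has_sum_cmult_right parseval_cinner some_onb)
  ultimately show ?thesis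
    unfolding hs_inner_def op_trace_def
    by (simp only: infsumI cinner_mult_commuted norm_cinner_commute[of \<eta>])
qed

text \<open>The adjoint of \<open>T\<close> is \<open>Q\<close> after the adjoint of
  \<open>B\<close>. Absorbing \<open>Q\<close> into the left factor leaves the trace of a product of
  two Hilbert-Schmidt operators; a second expansion splits \<open>S\<close> between \<open>A\<close>
  and \<open>R\<close>.\<close>

lemma hs_inner_conj_rep_eq:
  fixes \<pi> :: "'g::topological_group_add \<Rightarrow> 'h::chilbert_space \<Rightarrow> 'h"
  assumes \<pi>: "unitary_rep \<pi>"
    and A: "bounded_clinear A" and R: "positive_op R" and S: "\<And>x. S x = A (R x)"
    and B: "bounded_clinear B" and Q: "positive_op Q" and T: "\<And>x. T x = B (Q x)"
    and Bs: "(\<lambda>f. (norm (B f))\<^sup>2) summable_on some_onb"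
    and Qs: "(\<lambda>f. (norm (Q f))\<^sup>2) summable_on some_onb"
  shows "hs_inner (conj_rep \<pi> g S) T =
    (\<Sum>\<^sub>\<infinity>f\<in>some_onb. \<Sum>\<^sub>\<infinity>e\<in>some_onb. cinner (Q f) (\<pi> g (R e)) * cinner (\<pi> g (A e)) (B f))"
proof -
  let ?E = "some_onb :: 'h set"
  define Z where "Z x = \<pi> g (S (\<pi> (- g) (Q x)))" for x
  have Sb: "bounded_clinear S"
    using bounded_clinear_compose[OF A positive_op_bounded_clinear[OF R]] by (simp add: S[symmetric])
  have U: "bounded_clinear (\<lambda>x. \<pi> g (S (\<pi> (- g) x)))"
    by (rule bounded_clinear_compose[OF unitary_rep_bounded_clinear[OF \<pi>]
          bounded_clinear_compose[OF Sb unitary_rep_bounded_clinear[OF \<pi>]]])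
  have Zb: "bounded_clinear Z"
    unfolding Z_def[abs_def]
    by (rule bounded_clinear_compose[OF U positive_op_bounded_clinear[OF Q]])
  obtain K where K: "K > 0" "\<And>x. norm (\<pi> g (S (\<pi> (- g) x))) \<le> K * norm x"
    using bounded_clinear_bound[OF U] by blast
  \<comment> \<open>The ideal property of Hilbert-Schmidt operators: \<open>Z\<close> is a bounded
    operator applied after \<open>Q\<close>.\<close>
  have Zs: "(\<lambda>f. (norm (Z f))\<^sup>2) summable_on ?E"
  proof (rule summable_on_comparison_test)
    show "(\<lambda>f. K\<^sup>2 * (norm (Q f))\<^sup>2) summable_on ?E"
      by (intro summable_on_cmult_right Qs)
    show "(norm (Z f))\<^sup>2 \<le> K\<^sup>2 * (norm (Q f))\<^sup>2" for f
      using power_mono[OF K(2)[of "Q f"], of 2] by (simp add: Z_def power_mult_distrib)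
  qed simp
  have Zf: "cinner (Z f) (B f)
      = (\<Sum>\<^sub>\<infinity>e\<in>?E. cinner (Q f) (\<pi> g (R e)) * cinner (\<pi> g (A e)) (B f))" for f
  proof -
    let ?w = "\<pi> (- g) (Q f)" and ?v = "\<pi> (- g) (B f)"
    have "cinner (Z f) (B f) = cinner (R ?w) (cadjoint A ?v)"
      by (simp add: Z_def S unitary_rep_cinner_left[OF \<pi>, of g] cinner_cadjoint[OF A])
    also have "\<dots> = (\<Sum>\<^sub>\<infinity>e\<in>?E. cinner (R ?w) e * cinner e (cadjoint A ?v))"
      by (rule infsumI[symmetric]) (rule parseval_cinner[OF some_onb])
    also have "\<dots> = (\<Sum>\<^sub>\<infinity>e\<in>?E. cinner (Q f) (\<pi> g (R e)) * cinner (\<pi> g (A e)) (B f))"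
      using unitary_rep_cinner_left[OF \<pi>, of "- g" "Q f" "R e" for e] unitary_rep_cinner_left[OF \<pi>, of g "A e" "B f" for e]
      by (simp add: positive_op_hermitian[OF R] cinner_cadjoint[OF A, symmetric])
    finally show ?thesis .
  qed
  have "cadjoint T = (\<lambda>x. Q (cadjoint B x))"
    by (rule cadjoint_eqI) (simp add: T cinner_cadjoint[OF B] positive_op_hermitian[OF Q])
  then have "hs_inner (conj_rep \<pi> g S) T = op_trace (Z \<circ> cadjoint B)"
    by (simp add: hs_inner_def conj_rep_def Z_def comp_def)
  also have "\<dots> = (\<Sum>\<^sub>\<infinity>f\<in>?E. cinner (Z f) (B f))"
    by (rule op_trace_comp_cadjoint[OF Zb Zs B Bs])
  finally show ?thesis
    by (simp only: Zf)
qed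

text \<open>An infinite triangle inequality that also covers non-summable \<open>g\<close>, because
  \<open>infsum\<close> then has the default value 0. Passing from \<open>E\<close> to
  \<open>E0\<close> makes the index set countable in the application.\<close>

lemma norm_infsum_le_nn_integral:
  fixes g :: "'a \<Rightarrow> complex"
  assumes "\<And>e. e \<in> E - E0 \<Longrightarrow> g e = 0" "E0 \<subseteq> E"
  shows "ennreal (norm (infsum g E)) \<le> (\<integral>\<^sup>+e. ennreal (norm (g e)) \<partial>count_space E0)"
proof -
  have eq: "infsum g E = infsum g E0"
    by (rule infsum_cong_neutral) (use assms in auto)
  show ?thesis
  proof (cases "g summable_on E0 \<and> (\<integral>\<^sup>+e. ennreal (norm (g e)) \<partial>count_space E0) < \<infinity>")
    case True
    then obtain C where C: "C \<ge> 0" "(\<integral>\<^sup>+e. ennreal (norm (g e)) \<partial>count_space E0) = ennreal C"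
      by (cases "\<integral>\<^sup>+e. ennreal (norm (g e)) \<partial>count_space E0") auto
    have "norm (sum g F) \<le> C" if F: "finite F" "F \<subseteq> E0" for F
    proof -
      have "ennreal (norm (sum g F)) \<le> ennreal (\<Sum>e\<in>F. norm (g e))"
        by (intro ennreal_leI norm_sum)
      also have "\<dots> = (\<integral>\<^sup>+e. ennreal (norm (g e)) \<partial>count_space F)"
        using F by (simp add: nn_integral_count_space_finite sum_ennreal)
      also have "\<dots> = (\<integral>\<^sup>+e. ennreal (norm (g e)) * indicator F e \<partial>count_space E0)"
        using F by (subst nn_integral_restrict_space[symmetric]) (auto simp: restrict_count_space Int_absorb2)
      also have "\<dots> \<le> ennreal C"
        unfolding C(2)[symmetric] by (intro nn_integral_mono) (auto split: split_indicator)
      finally show ?thesis using C(1) by simp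
    qed
    then have "\<forall>\<^sub>F F in finite_subsets_at_top E0. norm (sum g F) \<le> C"
      by (intro eventually_finite_subsets_at_top_weakI) auto
    moreover have "((\<lambda>F. norm (sum g F)) \<longlongrightarrow> norm (infsum g E0)) (finite_subsets_at_top E0)"
      using True by (intro tendsto_norm infsum_tendsto) simp
    ultimately have "norm (infsum g E0) \<le> C"
      by (intro tendsto_upperbound[OF _ _ finite_subsets_at_top_neq_bot])
    then show ?thesis
      by (simp add: eq C(2) ennreal_leI)
  next
    case False
    then show ?thesis
      by (cases "g summable_on E0") (auto simp: eq infsum_not_exists not_less top.extremum_unique)
  qed
qed

lemma nn_integral_count_space_has_sum:
  fixes h :: "'a \<Rightarrow> real"
  assumes h: "(h has_sum s) E" "\<And>e. e \<in> E \<Longrightarrow> 0 \<le> h e" and E0: "E0 \<subseteq> E" "\<And>e. e \<in> E - E0 \<Longrightarrow> h e = 0"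
  shows "(\<integral>\<^sup>+e. ennreal (h e) \<partial>count_space E0) = ennreal s"
proof -
  have "(h has_sum s) E0"
    using h(1) by (rule has_sum_cong_neutral[THEN iffD1, rotated 3]) (use E0 in auto)
  then have "h summable_on E0" "infsum h E0 = s"
    by (auto simp: has_sum_iff)
  moreover have "Infinite_Set_Sum.abs_summable_on h E0"
    using calculation(1) by (simp only: abs_summable_equivalent[symmetric] summable_on_iff_abs_summable_on_real[symmetric])
  ultimately show ?thesis
    using nn_integral_conv_infsetsum[of h E0] infsetsum_infsum[of h E0] h(2) E0(1) by auto
qed

subsection \<open>Integrals of matrix coefficients\<close>

lemma unitary_rep_coefficient_measurable:
  fixes \<mu> :: "'g::topological_group_add measure" and \<pi> :: "'g \<Rightarrow> 'h::chilbert_space \<Rightarrow> 'h"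
  assumes "unitary_rep \<pi>" "sets \<mu> = sets borel"
  shows "(\<lambda>g. norm (cinner (\<pi> g \<xi>) \<eta>)) \<in> borel_measurable \<mu>"
proof -
  have "continuous_on UNIV (\<lambda>g. norm (cinner (\<pi> g \<xi>) \<eta>))"
    by (intro continuous_on_norm cinner.continuous_on continuous_on_const
        unitary_rep_continuous[OF assms(1)])
  then have "(\<lambda>g. norm (cinner (\<pi> g \<xi>) \<eta>)) \<in> borel_measurable borel"
    by (rule borel_measurable_continuous_onI)
  then show ?thesis
    by (subst measurable_cong_sets[OF assms(2) refl])
qed

text \<open>Enumerating the index set turns the integral into a series of measurable functions.
  Countability matters, since arbitrary sums of measurable functions can fail to be
  measurable.\<close>

lemma borel_measurable_nn_integral_count_space:
  fixes f :: "'i \<Rightarrow> 'a \<Rightarrow> ennreal"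
  assumes "countable I" and [measurable]: "\<And>i. i \<in> I \<Longrightarrow> f i \<in> borel_measurable M"
  shows "(\<lambda>x. \<integral>\<^sup>+i. f i x \<partial>count_space I) \<in> borel_measurable M"
proof (cases "finite I")
  case True
  then show ?thesis
    by (simp add: nn_integral_count_space_finite)
next
  case False
  then have [simp]: "I \<noteq> {}" by auto
  note * = bij_betw_from_nat_into[OF \<open>countable I\<close> False]
  have "(\<integral>\<^sup>+i. h i \<partial>count_space I) = (\<Sum>n. h (from_nat_into I n))" for h :: "'i \<Rightarrow> ennreal"
    by (simp add: nn_integral_bij_count_space[symmetric, OF *] nn_integral_count_space_nat)
  then show ?thesis
    by (simp add: from_nat_into)
qed

lemma nn_integral_hs_inner_le:
  fixes \<mu> :: "'g::topological_group_add measure" and \<pi> :: "'g \<Rightarrow> 'h::chilbert_space \<Rightarrow> 'h"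
  assumes \<pi>: "unitary_rep \<pi>" and sets: "sets \<mu> = sets borel" and c: "c \<ge> 0"
    and bound: "\<And>\<xi> \<eta>. (\<integral>\<^sup>+g. ennreal ((norm (cinner (\<pi> g \<xi>) \<eta>))\<^sup>2) \<partial>\<mu>)
      \<le> ennreal (c * ((norm \<xi>)\<^sup>2 * (norm \<eta>)\<^sup>2))"
    and S: "trace_class S" and T: "trace_class T"
  shows "(\<integral>\<^sup>+g. ennreal (norm (hs_inner (conj_rep \<pi> g S) T)) \<partial>\<mu>)
    \<le> ennreal (c * (trace_norm S * trace_norm T))"
proof -
  let ?E = "some_onb :: 'h set"
  obtain A R where A: "bounded_clinear A" and R: "positive_op R" and S_eq: "\<And>x. S x = A (R x)"
    and AR: "\<And>x. norm (A x) = norm (R x)" and Rs: "((\<lambda>e. (norm (R e))\<^sup>2) has_sum trace_norm S) ?E"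
    using trace_class_factorization[OF S] by blast
  obtain B Q where B: "bounded_clinear B" and Q: "positive_op Q" and T_eq: "\<And>x. T x = B (Q x)"
    and BQ: "\<And>x. norm (B x) = norm (Q x)" and Qs: "((\<lambda>e. (norm (Q e))\<^sup>2) has_sum trace_norm T) ?E"
    using trace_class_factorization[OF T] by blast
  \<comment> \<open>A square summable family has countable support, and basis vectors outside it
    contribute nothing to the double series. Countability lets the sums be exchanged with the
    integral over \<mu>.\<close>
  define E0 where "E0 = {e\<in>?E. R e \<noteq> 0}"
  define F0 where "F0 = {f\<in>?E. Q f \<noteq> 0}"
  have countable: "countable E0" "countable F0"
    using summable_countable_real[OF has_sum_imp_summable[OF Rs]]
      summable_countable_real[OF has_sum_imp_summable[OF Qs]] by (simp_all add: E0_def F0_def)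
  note [measurable] = unitary_rep_coefficient_measurable[OF \<pi> sets]
  define u where "u f e g = (1/2) * ((norm (cinner (\<pi> g (R e)) (Q f)))\<^sup>2 + (norm (cinner (\<pi> g (A e)) (B f)))\<^sup>2)"
    for f e g
  have [measurable]: "u f e \<in> borel_measurable \<mu>" for f e
    unfolding u_def by measurable
  have Qs': "(\<lambda>f. (norm (Q f))\<^sup>2) summable_on ?E" "(\<lambda>f. (norm (B f))\<^sup>2) summable_on ?E"
    using has_sum_imp_summable[OF Qs] by (simp_all add: BQ)
  have pw: "ennreal (norm (hs_inner (conj_rep \<pi> g S) T))
      \<le> (\<integral>\<^sup>+f. \<integral>\<^sup>+e. ennreal (u f e g) \<partial>count_space E0 \<partial>count_space F0)" for g
  proof -
    let ?a = "\<lambda>f e. cinner (Q f) (\<pi> g (R e)) * cinner (\<pi> g (A e)) (B f)"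
    have a: "norm (?a f e) \<le> u f e g" for f e
      \<comment> \<open>AM-GM\<close>
      using sum_squares_bound[of "norm (cinner (\<pi> g (R e)) (Q f))" "norm (cinner (\<pi> g (A e)) (B f))"]
      by (simp add: norm_mult u_def norm_cinner_commute[of "Q f"])
    have "ennreal (norm (\<Sum>\<^sub>\<infinity>f\<in>?E. \<Sum>\<^sub>\<infinity>e\<in>?E. ?a f e))
        \<le> (\<integral>\<^sup>+f. ennreal (norm (\<Sum>\<^sub>\<infinity>e\<in>?E. ?a f e)) \<partial>count_space F0)"
      by (rule norm_infsum_le_nn_integral) (auto simp: F0_def cinner.zero_left)
    also have "\<dots> \<le> (\<integral>\<^sup>+f. \<integral>\<^sup>+e. ennreal (norm (?a f e)) \<partial>count_space E0 \<partial>count_space F0)"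
    proof (intro nn_integral_mono norm_infsum_le_nn_integral)
      fix f e assume "e \<in> ?E - E0"
      then have "R e = 0" by (auto simp: E0_def)
      then show "?a f e = 0"
        using unitary_rep_norm[OF \<pi>, of g 0] by (simp add: cinner.zero_right)
    qed (auto simp: E0_def)
    also have "\<dots> \<le> (\<integral>\<^sup>+f. \<integral>\<^sup>+e. ennreal (u f e g) \<partial>count_space E0 \<partial>count_space F0)"
      by (intro nn_integral_mono ennreal_leI a)
    finally show ?thesis
      unfolding hs_inner_conj_rep_eq[OF \<pi> A R S_eq B Q T_eq Qs'(2) Qs'(1)] .
  qed
  have int_u: "(\<integral>\<^sup>+g. ennreal (u f e g) \<partial>\<mu>) \<le> ennreal (c * ((norm (R e))\<^sup>2 * (norm (Q f))\<^sup>2))" for f e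
  proof -
    have "(\<integral>\<^sup>+g. ennreal (u f e g) \<partial>\<mu>) =
        ennreal (1/2) * ((\<integral>\<^sup>+g. ennreal ((norm (cinner (\<pi> g (R e)) (Q f)))\<^sup>2) \<partial>\<mu>)
          + (\<integral>\<^sup>+g. ennreal ((norm (cinner (\<pi> g (A e)) (B f)))\<^sup>2) \<partial>\<mu>))"
      unfolding u_def by (subst ennreal_mult) (simp_all add: nn_integral_cmult nn_integral_add)
    also have "\<dots> \<le> ennreal (1/2) * (ennreal (c * ((norm (R e))\<^sup>2 * (norm (Q f))\<^sup>2))
        + ennreal (c * ((norm (A e))\<^sup>2 * (norm (B f))\<^sup>2)))"
      by (intro mult_left_mono add_mono bound) simp
    \<comment> \<open>The norm equalities for \<open>A\<close> and \<open>B\<close> make both halves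
      equal, so the factor 1/2 cancels.\<close>
    also have "\<dots> = ennreal (c * ((norm (R e))\<^sup>2 * (norm (Q f))\<^sup>2))"
      unfolding AR BQ
    proof (subst ennreal_plus[symmetric])
      show "ennreal (1/2) * ennreal (c * ((norm (R e))\<^sup>2 * (norm (Q f))\<^sup>2) + c * ((norm (R e))\<^sup>2 * (norm (Q f))\<^sup>2))
          = ennreal (c * ((norm (R e))\<^sup>2 * (norm (Q f))\<^sup>2))"
        using c by (subst ennreal_mult[symmetric]) auto
    qed (use c in auto)
    finally show ?thesis .
  qed
  \<comment> \<open>Only integrands are compared here: the trace, a possibly uncountable sum, is
    replaced by a countable majorant whose measurability is clear.\<close>
  have "(\<integral>\<^sup>+g. ennreal (norm (hs_inner (conj_rep \<pi> g S) T)) \<partial>\<mu>)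
      \<le> (\<integral>\<^sup>+g. \<integral>\<^sup>+f. \<integral>\<^sup>+e. ennreal (u f e g) \<partial>count_space E0 \<partial>count_space F0 \<partial>\<mu>)"
    by (intro nn_integral_mono pw)
  also have "\<dots> = (\<integral>\<^sup>+f. \<integral>\<^sup>+g. \<integral>\<^sup>+e. ennreal (u f e g) \<partial>count_space E0 \<partial>\<mu> \<partial>count_space F0)"
    using countable by (intro nn_integral_count_space_nn_integral borel_measurable_nn_integral_count_space) auto
  also have "\<dots> = (\<integral>\<^sup>+f. \<integral>\<^sup>+e. \<integral>\<^sup>+g. ennreal (u f e g) \<partial>\<mu> \<partial>count_space E0 \<partial>count_space F0)"
    using countable by (intro nn_integral_cong nn_integral_count_space_nn_integral) auto
  also have "\<dots> \<le> (\<integral>\<^sup>+f. \<integral>\<^sup>+e. ennreal (c * ((norm (R e))\<^sup>2 * (norm (Q f))\<^sup>2)) \<partial>count_space E0 \<partial>count_space F0)"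
    by (intro nn_integral_mono int_u)
  also have "\<dots> = (\<integral>\<^sup>+f. ennreal c * ennreal ((norm (Q f))\<^sup>2) *
      (\<integral>\<^sup>+e. ennreal ((norm (R e))\<^sup>2) \<partial>count_space E0) \<partial>count_space F0)"
    using c by (intro nn_integral_cong, subst nn_integral_cmult[symmetric])
      (auto simp: ennreal_mult[symmetric] mult_ac)
  also have "(\<integral>\<^sup>+e. ennreal ((norm (R e))\<^sup>2) \<partial>count_space E0) = ennreal (trace_norm S)"
    by (rule nn_integral_count_space_has_sum[OF Rs]) (auto simp: E0_def)
  also have "(\<integral>\<^sup>+f. ennreal c * ennreal ((norm (Q f))\<^sup>2) * ennreal (trace_norm S) \<partial>count_space F0)
      = ennreal c * (\<integral>\<^sup>+f. ennreal ((norm (Q f))\<^sup>2) \<partial>count_space F0) * ennreal (trace_norm S)"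
    by (simp add: nn_integral_cmult nn_integral_multc)
  also have "(\<integral>\<^sup>+f. ennreal ((norm (Q f))\<^sup>2) \<partial>count_space F0) = ennreal (trace_norm T)"
    by (rule nn_integral_count_space_has_sum[OF Qs]) (auto simp: F0_def)
  also have "ennreal c * ennreal (trace_norm T) * ennreal (trace_norm S) = ennreal (c * (trace_norm S * trace_norm T))"
    using c has_sum_nonneg[OF Rs] has_sum_nonneg[OF Qs] by (simp add: ennreal_mult mult_ac)
  finally show ?thesis .
qed

text \<open>A uniform boundedness principle in which \<open>p\<close> behaves like a squared
  seminorm: finiteness covers the space by closed sublevel sets, so one of them contains a ball, and
  homogeneity spreads the bound from there.\<close>

lemma baire_quadratic_bound:
  fixes p :: "'h::{real_normed_vector, complete_space} \<Rightarrow> ennreal"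
  assumes closed: "\<And>n. closed {x. p x \<le> of_nat n}"
    and diff: "\<And>x y. p (x - y) \<le> 2 * p x + 2 * p y"
    and scale: "\<And>r x. p (r *\<^sub>R x) = ennreal (r\<^sup>2) * p x"
    and fin: "\<And>x. p x < \<infinity>"
  obtains c where "c \<ge> 0" "\<And>x. p x \<le> ennreal (c * (norm x)\<^sup>2)"
proof -
  have "\<exists>n. interior {x. p x \<le> of_nat n} \<noteq> {}"
  proof (rule ccontr)
    assume empty: "\<not> ?thesis"
    have "(euclidean :: 'h topology) interior_of \<Union>(range (\<lambda>n::nat. {x. p x \<le> of_nat n})) = {}"
    proof (rule Baire_category_alt)
      show "completely_metrizable_space (euclidean :: 'h topology) \<or>
          locally_compact_space (euclidean :: 'h topology) \<and> regular_space (euclidean :: 'h topology)"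
        using completely_metrizable_space_euclidean by blast
    qed (use empty closed in \<open>auto simp: closed_closedin[symmetric]\<close>)
    moreover have "\<Union>(range (\<lambda>n::nat. {x. p x \<le> of_nat n})) = UNIV"
    proof -
      have "\<exists>n::nat. p x \<le> of_nat n" for x
        using ennreal_Ex_less_of_nat[of "p x"] fin[of x] by (auto intro: less_imp_le)
      then show ?thesis by auto
    qed
    ultimately show False by simp
  qed
  then obtain n :: nat and x0 where "x0 \<in> interior {x. p x \<le> of_nat n}"
    by blast
  then obtain r where r: "r > 0" "cball x0 r \<subseteq> {x. p x \<le> of_nat n}"
    unfolding mem_interior_cball by blast
  \<comment> \<open>Writing \<open>x\<close> as \<open>(x0 + x) - x0\<close> recentres the ball at
    the origin, at the cost of the factor 4 from \<open>diff\<close>.\<close>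
  have small: "p x \<le> 4 * of_nat n" if "norm x \<le> r" for x
  proof -
    have "x0 + x \<in> cball x0 r" "x0 \<in> cball x0 r"
      using that r(1) by (auto simp: dist_norm)
    then have "p (x0 + x) \<le> of_nat n" "p x0 \<le> of_nat n"
      using r(2) by blast+
    then have "2 * p (x0 + x) + 2 * p x0 \<le> 2 * of_nat n + 2 * of_nat n"
      by (intro add_mono mult_left_mono) auto
    moreover have "(2::ennreal) * of_nat n + 2 * of_nat n = 4 * of_nat n"
      by (simp add: distrib_right[symmetric])
    ultimately show ?thesis
      using diff[of "x0 + x" x0] by simp
  qed
  \<comment> \<open>Obtained by scaling from the sphere of radius \<open>r\<close>, where
    \<open>p\<close> is at most 4 n.\<close>
  define c where "c = 4 * real n / r\<^sup>2"
  show ?thesis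
  proof (rule that[of c])
    show "c \<ge> 0" by (simp add: c_def)
    show "p x \<le> ennreal (c * (norm x)\<^sup>2)" for x
    proof (cases "x = 0")
      case True
      then show ?thesis using scale[of 0 0] by simp
    next
      case False
      define y where "y = (r / norm x) *\<^sub>R x"
      have "x = (norm x / r) *\<^sub>R y"
        using False r(1) by (simp add: y_def)
      then have "p x = ennreal ((norm x / r)\<^sup>2) * p y"
        using scale[of "norm x / r" y] by simp
      also have "\<dots> \<le> ennreal ((norm x / r)\<^sup>2) * (4 * of_nat n)"
        using False r(1) by (intro mult_left_mono small) (auto simp: y_def)
      also have "(4::ennreal) * of_nat n = ennreal (4 * real n)"
        by (simp add: ennreal_mult ennreal_of_nat_eq_real_of_nat)
      also have "ennreal ((norm x / r)\<^sup>2) * ennreal (4 * real n) = ennreal (c * (norm x)\<^sup>2)"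
        by (simp add: c_def ennreal_mult[symmetric] power_divide mult_ac)
      finally show ?thesis .
    qed
  qed
qed

text \<open>The integrands converge pointwise along a convergent sequence of parameters, so the
  integral is lower semicontinuous; sequences suffice in a metric space.\<close>

lemma closed_nn_integral_sublevel:
  fixes f :: "'h::metric_space \<Rightarrow> 'a \<Rightarrow> ennreal"
  assumes meas: "\<And>x. f x \<in> borel_measurable M" and cont: "\<And>a. continuous_on UNIV (\<lambda>x. f x a)"
  shows "closed {x. (\<integral>\<^sup>+a. f x a \<partial>M) \<le> C}"
  unfolding closed_sequential_limits
proof (intro allI impI CollectI, elim conjE)
  fix x l assume x: "\<forall>n::nat. x n \<in> {x. (\<integral>\<^sup>+a. f x a \<partial>M) \<le> C}" "x \<longlonglongrightarrow> l"
  have "(\<integral>\<^sup>+a. f l a \<partial>M) = (\<integral>\<^sup>+a. liminf (\<lambda>n. f (x n) a) \<partial>M)"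
  proof (intro nn_integral_cong)
    fix a
    have "(\<lambda>n. f (x n) a) \<longlonglongrightarrow> f l a"
      by (rule continuous_on_tendsto_compose[OF cont x(2)]) auto
    then show "f l a = liminf (\<lambda>n. f (x n) a)"
      by (simp add: lim_imp_Liminf)
  qed
  also have "\<dots> \<le> liminf (\<lambda>n. \<integral>\<^sup>+a. f (x n) a \<partial>M)"
    by (rule nn_integral_liminf) (rule meas)
  also have "\<dots> \<le> C"
    using x(1) by (intro Liminf_le) auto
  finally show "(\<integral>\<^sup>+a. f l a \<partial>M) \<le> C" .
qed

lemma norm_diff_square_le:
  fixes a b :: "'a::real_normed_vector"
  shows "(norm (a - b))\<^sup>2 \<le> 2 * (norm a)\<^sup>2 + 2 * (norm b)\<^sup>2"
proof -
  have "(norm (a - b))\<^sup>2 \<le> (norm a + norm b)\<^sup>2"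
    by (intro power_mono norm_triangle_ineq4) simp
  then show ?thesis
    using sum_squares_bound[of "norm a" "norm b"] by (simp add: power2_sum)
qed

text \<open>Uniformity is needed in both vectors: the category argument is applied first in \<xi>
  for fixed \<eta>, and then to the supremum over the unit ball in \<xi>, as for separately bounded
  bilinear maps.\<close>

lemma coefficients_uniformly_bounded:
  fixes \<mu> :: "'g::topological_group_add measure" and \<pi> :: "'g \<Rightarrow> 'h::chilbert_space \<Rightarrow> 'h"
  assumes \<pi>: "unitary_rep \<pi>" and sets: "sets \<mu> = sets borel"
    and fin: "\<And>\<xi> \<eta>. (\<integral>\<^sup>+g. ennreal ((norm (cinner (\<pi> g \<xi>) \<eta>))\<^sup>2) \<partial>\<mu>) < \<infinity>"
  obtains c where "c \<ge> 0" "\<And>\<xi> \<eta>. (\<integral>\<^sup>+g. ennreal ((norm (cinner (\<pi> g \<xi>) \<eta>))\<^sup>2) \<partial>\<mu>)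
      \<le> ennreal (c * ((norm \<xi>)\<^sup>2 * (norm \<eta>)\<^sup>2))"
proof -
  define I where "I \<xi> \<eta> = (\<integral>\<^sup>+g. ennreal ((norm (cinner (\<pi> g \<xi>) \<eta>))\<^sup>2) \<partial>\<mu>)" for \<xi> \<eta>
  note [measurable] = unitary_rep_coefficient_measurable[OF \<pi> sets]
  note lin = linear_simps[OF bounded_clinear_bounded_linear[OF unitary_rep_bounded_clinear[OF \<pi>]]]
  note bl = bounded_clinear_bounded_linear[OF unitary_rep_bounded_clinear[OF \<pi>]]
  have split: "(\<integral>\<^sup>+g. ennreal (2 * (norm (cinner (\<pi> g x) y))\<^sup>2 + 2 * (norm (cinner (\<pi> g x') y'))\<^sup>2) \<partial>\<mu>)
      = 2 * I x y + 2 * I x' y'" for x y x' y'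
    unfolding I_def by (simp add: ennreal_mult nn_integral_add nn_integral_cmult)
  have scale: "I (r *\<^sub>R \<xi>) \<eta> = ennreal (r\<^sup>2) * I \<xi> \<eta>" "I \<xi> (r *\<^sub>R \<eta>) = ennreal (r\<^sup>2) * I \<xi> \<eta>" for r \<xi> \<eta>
    unfolding I_def
    by (simp_all add: lin cinner.scaleR_left cinner.scaleR_right power_mult_distrib ennreal_mult nn_integral_cmult)
  have diff: "I (x - y) \<eta> \<le> 2 * I x \<eta> + 2 * I y \<eta>" "I \<xi> (x - y) \<le> 2 * I \<xi> x + 2 * I \<xi> y" for x y \<xi> \<eta>
    unfolding split[symmetric] unfolding I_def
    by (auto intro!: nn_integral_mono ennreal_leI norm_diff_square_le
        simp: lin cinner.diff_left cinner.diff_right simp del: ennreal_plus)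
  have closed: "closed {x. I x \<eta> \<le> C}" "closed {y. I \<xi> y \<le> C}" for \<xi> \<eta> C
    unfolding I_def
    by (intro closed_nn_integral_sublevel continuous_on_ennreal continuous_intros cinner.continuous_on
        bounded_linear.continuous_on[OF bl]; measurable)+
  \<comment> \<open>As a supremum, \<open>P\<close> inherits closed sublevel sets, the inequality
    for differences and homogeneity in \<eta>. Its finiteness is the point that needs an
    argument.\<close>
  define P where "P \<eta> = (SUP \<xi>\<in>cball 0 1. I \<xi> \<eta>)" for \<eta>
  have P: "I \<xi> \<eta> \<le> ennreal ((norm \<xi>)\<^sup>2) * P \<eta>" for \<xi> \<eta>
  proof (cases "\<xi> = 0")
    case True
    then show ?thesis using scale(1)[of 0 0 \<eta>] by simp
  next
    case False
    have "I \<xi> \<eta> = ennreal ((norm \<xi>)\<^sup>2) * I (\<xi> /\<^sub>R norm \<xi>) \<eta>"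
      using False scale(1)[of "norm \<xi>" "\<xi> /\<^sub>R norm \<xi>" \<eta>] by simp
    also have "I (\<xi> /\<^sub>R norm \<xi>) \<eta> \<le> P \<eta>"
      unfolding P_def by (rule SUP_upper) (use False in simp)
    finally show ?thesis by (simp add: mult_left_mono)
  qed
  obtain c where c: "c \<ge> 0" "\<And>\<eta>. P \<eta> \<le> ennreal (c * (norm \<eta>)\<^sup>2)"
  proof (rule baire_quadratic_bound[of P])
    show "closed {\<eta>. P \<eta> \<le> of_nat n}" for n
    proof -
      have "{\<eta>. P \<eta> \<le> of_nat n} = (\<Inter>\<xi>\<in>cball 0 1. {\<eta>. I \<xi> \<eta> \<le> of_nat n})"
        by (auto simp: P_def SUP_le_iff)
      then show ?thesis using closed(2) by auto
    qed
    show "P (x - y) \<le> 2 * P x + 2 * P y" for x y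
      unfolding P_def
    proof (rule SUP_least)
      fix \<xi> :: 'h assume "\<xi> \<in> cball 0 1"
      then show "I \<xi> (x - y) \<le> 2 * (SUP \<xi>\<in>cball 0 1. I \<xi> x) + 2 * (SUP \<xi>\<in>cball 0 1. I \<xi> y)"
        by (intro order_trans[OF diff(2)] add_mono mult_left_mono SUP_upper) auto
    qed
    show "P (r *\<^sub>R x) = ennreal (r\<^sup>2) * P x" for r x
      unfolding P_def scale by (simp add: SUP_mult_left_ennreal)
    show "P \<eta> < \<infinity>" for \<eta>
    proof -
      \<comment> \<open>This inner use of Baire has a bound \<open>b\<close> depending on \<eta>,
        which is enough for finiteness of \<open>P \<eta>\<close>.\<close>
      obtain b where b: "b \<ge> 0" "\<And>\<xi>. I \<xi> \<eta> \<le> ennreal (b * (norm \<xi>)\<^sup>2)"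
        using baire_quadratic_bound[of "\<lambda>\<xi>. I \<xi> \<eta>"] closed(1) diff(1) scale(1) fin[folded I_def] by blast
      have "P \<eta> \<le> ennreal b"
        unfolding P_def
      proof (rule SUP_least)
        fix \<xi> :: 'h assume "\<xi> \<in> cball 0 1"
        then have "b * (norm \<xi>)\<^sup>2 \<le> b"
          using b(1) by (intro mult_left_le) (auto simp: power_le_one)
        then show "I \<xi> \<eta> \<le> ennreal b"
          using b(2)[of \<xi>] by (meson ennreal_leI order_trans)
      qed
      then show ?thesis by (simp add: le_less_trans)
    qed
  qed blast
  have "I \<xi> \<eta> \<le> ennreal (c * ((norm \<xi>)\<^sup>2 * (norm \<eta>)\<^sup>2))" for \<xi> \<eta>
  proof -
    have "I \<xi> \<eta> \<le> ennreal ((norm \<xi>)\<^sup>2) * ennreal (c * (norm \<eta>)\<^sup>2)"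
      using order_trans[OF P mult_left_mono[OF c(2)]] by simp
    then show ?thesis
      using c(1) by (simp add: ennreal_mult[symmetric] mult_ac)
  qed
  then show ?thesis
    using that[of c] c(1) by (simp add: I_def)
qed

theorem proposition1p1:
  fixes \<mu> :: "'g::{topological_group_add, second_countable_topology, t2_space} measure"
    and \<pi> :: "'g \<Rightarrow> 'h::chilbert_space \<Rightarrow> 'h"
  assumes "locally_compact_space (euclidean :: 'g topology)"
    and "sets \<mu> = sets borel"
    and "\<And>K :: 'g set. compact K \<Longrightarrow> emeasure \<mu> K < \<infinity>"
    and "unitary_rep \<pi>"
  shows
    "((\<exists>C>0. \<forall>S T. trace_class S \<and> trace_class T \<and> trace_norm S = 1 \<and> trace_norm T = 1 \<longrightarrow>
         (\<integral>\<^sup>+ g. ennreal (norm (hs_inner (conj_rep \<pi> g S) T)) \<partial>\<mu>) < ennreal C)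
      \<longleftrightarrow>
      (\<exists>C>0. \<forall>\<xi> \<eta>. norm \<xi> = 1 \<and> norm \<eta> = 1 \<longrightarrow>
         (\<integral>\<^sup>+ g. ennreal ((norm (cinner (\<pi> g \<xi>) \<eta>))\<^sup>2) \<partial>\<mu>) < ennreal C))
     \<and>
     ((\<exists>C>0. \<forall>\<xi> \<eta>. norm \<xi> = 1 \<and> norm \<eta> = 1 \<longrightarrow>
         (\<integral>\<^sup>+ g. ennreal ((norm (cinner (\<pi> g \<xi>) \<eta>))\<^sup>2) \<partial>\<mu>) < ennreal C)
      \<longleftrightarrow>
      (\<forall>S T. trace_class S \<and> trace_class T \<longrightarrow>
         (\<integral>\<^sup>+ g. ennreal (norm (hs_inner (conj_rep \<pi> g S) T)) \<partial>\<mu>) < \<infinity>))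
     \<and>
     ((\<forall>S T. trace_class S \<and> trace_class T \<longrightarrow>
         (\<integral>\<^sup>+ g. ennreal (norm (hs_inner (conj_rep \<pi> g S) T)) \<partial>\<mu>) < \<infinity>)
      \<longleftrightarrow>
      (\<forall>\<xi> \<eta>. (\<integral>\<^sup>+ g. ennreal ((norm (cinner (\<pi> g \<xi>) \<eta>))\<^sup>2) \<partial>\<mu>) < \<infinity>))"
    (is "(?s1 \<longleftrightarrow> ?s2) \<and> (?s2 \<longleftrightarrow> ?s3) \<and> (?s3 \<longleftrightarrow> ?s4)")
proof -
  note \<pi> = \<open>unitary_rep \<pi>\<close> and sets = \<open>sets \<mu> = sets borel\<close>
  define I where "I \<xi> \<eta> = (\<integral>\<^sup>+g. ennreal ((norm (cinner (\<pi> g \<xi>) \<eta>))\<^sup>2) \<partial>\<mu>)" for \<xi> \<eta>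
  \<comment> \<open>The homogeneous uniform bound is the hub of the proof: (1) gives (2), each of
    (2) and (3) gives (4), (4) gives this bound, and this bound gives (1), (2) and (3).\<close>
  define bounded where "bounded \<longleftrightarrow> (\<exists>c\<ge>0. \<forall>\<xi> \<eta>. I \<xi> \<eta> \<le> ennreal (c * ((norm \<xi>)\<^sup>2 * (norm \<eta>)\<^sup>2)))"
  have rank_one: "(\<integral>\<^sup>+g. ennreal (norm (hs_inner (conj_rep \<pi> g (rank_one \<xi>)) (rank_one \<eta>))) \<partial>\<mu>) = I \<xi> \<eta>"
    for \<xi> \<eta>
    by (simp add: hs_inner_rank_one[OF \<pi>] I_def norm_power)
  have "?s1 \<Longrightarrow> ?s2"
  proof -
    assume ?s1
    then obtain C where "C > 0" and C: "\<And>S T. trace_class S \<Longrightarrow> trace_class T \<Longrightarrow>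
        trace_norm S = 1 \<Longrightarrow> trace_norm T = 1 \<Longrightarrow>
        (\<integral>\<^sup>+g. ennreal (norm (hs_inner (conj_rep \<pi> g S) T)) \<partial>\<mu>) < ennreal C"
      by blast
    have "I \<xi> \<eta> < ennreal C" if "norm \<xi> = 1" "norm \<eta> = 1" for \<xi> \<eta>
      unfolding rank_one[symmetric]
      by (rule C) (simp_all add: trace_class_rank_one trace_norm_rank_one that)
    with \<open>C > 0\<close> show ?s2 unfolding I_def by blast
  qed
  moreover have "?s3 \<Longrightarrow> ?s4"
    unfolding I_def[symmetric] unfolding rank_one[symmetric] using trace_class_rank_one by blast
  moreover have "?s4 \<Longrightarrow> bounded"
    by (rule coefficients_uniformly_bounded[OF \<pi> sets]) (auto simp: bounded_def I_def)
  moreover have "?s2 \<Longrightarrow> ?s4"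
  proof -
    assume ?s2
    then obtain C where C: "\<And>\<xi> \<eta>. norm \<xi> = 1 \<Longrightarrow> norm \<eta> = 1 \<Longrightarrow> I \<xi> \<eta> < ennreal C"
      unfolding I_def by blast
    have scale: "I (r *\<^sub>R x) (s *\<^sub>R y) = ennreal ((r * s)\<^sup>2) * I x y" for r s x y
    proof -
      note [measurable] = unitary_rep_coefficient_measurable[OF \<pi> sets]
      show ?thesis
        unfolding I_def
        by (simp add: linear_simps[OF bounded_clinear_bounded_linear[OF unitary_rep_bounded_clinear[OF \<pi>]]]
            cinner.scaleR_left cinner.scaleR_right power_mult_distrib ennreal_mult nn_integral_cmult mult_ac)
    qed
    have "I \<xi> \<eta> < \<infinity>" for \<xi> \<eta>
    proof (cases "\<xi> = 0 \<or> \<eta> = 0")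
      case True
      then show ?thesis
        using scale[of 0 0 1 \<eta>] scale[of 1 \<xi> 0 0] by auto
    next
      case False
      then have "I \<xi> \<eta> = ennreal ((norm \<xi> * norm \<eta>)\<^sup>2) * I (\<xi> /\<^sub>R norm \<xi>) (\<eta> /\<^sub>R norm \<eta>)"
        using scale[of "norm \<xi>" "\<xi> /\<^sub>R norm \<xi>" "norm \<eta>" "\<eta> /\<^sub>R norm \<eta>"] by simp
      moreover have "I (\<xi> /\<^sub>R norm \<xi>) (\<eta> /\<^sub>R norm \<eta>) < \<infinity>"
        using False C[of "\<xi> /\<^sub>R norm \<xi>" "\<eta> /\<^sub>R norm \<eta>"] by (auto intro: less_trans)
      ultimately show ?thesis
        by (simp add: ennreal_mult_less_top)
    qed
    then show ?s4 by (simp add: I_def)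
  qed
  moreover have "bounded \<Longrightarrow> ?s1 \<and> ?s2 \<and> ?s3"
  proof -
    assume bounded
    then obtain c where c: "c \<ge> 0" "\<And>\<xi> \<eta>. I \<xi> \<eta> \<le> ennreal (c * ((norm \<xi>)\<^sup>2 * (norm \<eta>)\<^sup>2))"
      unfolding bounded_def by blast
    have hs: "(\<integral>\<^sup>+g. ennreal (norm (hs_inner (conj_rep \<pi> g S) T)) \<partial>\<mu>)
        \<le> ennreal (c * (trace_norm S * trace_norm T))" if "trace_class S" "trace_class T" for S T
      using nn_integral_hs_inner_le[OF \<pi> sets c(1) c(2)[unfolded I_def] that] .
    \<comment> \<open>The bound by \<open>c\<close> is not strict and \<open>c\<close> may be 0;
      \<open>c + 1\<close> is positive and strictly larger.\<close>
    have less: "ennreal (c * (1 * 1)) < ennreal (c + 1)"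
      using c(1) by (simp add: ennreal_less_iff)
    have ?s1
      using c(1) le_less_trans[OF hs] less by (intro exI[of _ "c + 1"]) auto
    moreover have ?s2
      using c(1) le_less_trans[OF c(2)] less unfolding I_def by (intro exI[of _ "c + 1"]) auto
    moreover have ?s3
      using le_less_trans[OF hs] by auto
    ultimately show ?thesis by blast
  qed
  ultimately show ?thesis by blast
qed

end
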